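(* Let $(\mathcal G,z)$ be a canvas such that $\deg(A)\ge 4+|\tau(A)|$ for every non-empty $A\subsetneq V(\mathcal G)\setminus\{z\}$. If there exists a vertex $x\in V(\mathcal G)\setminus\{z\}$ such that $\deg(X)>\deg(z)-2$ for every $X\subseteq V(\mathcal G)\setminus\{z\}$ containing $x$, then every tip preflow extends to a nowhere-zero flow in $\mathcal G$.
   Context: Graphs are finite, loopless, and may have parallel edges. A $\mathbb{Z}_3$-boundary of a graph $G$ is a map $\beta:V(G)\to\mathbb{Z}_3$ with $\sum_{v\in V(C)}\beta(v)=0$ for every component $C$ of $G$; $\mathcal G=(G,\beta)$ is then a $\mathbb{Z}_3$-bordered graph. A nowhere-zero flow in $(G,\beta)$ is an orientation of $G$ with $\deg^+(v)-\deg^-(v)\equiv\beta(v)\pmod 3$ for every $v$. For $A\subseteq V(G)$, $\deg(A)$ is the number of edges with exactly one end in $A$, $\beta(A)=\sum_{v\in A}\beta(v)$, and $|\tau(A)|$ equals $0$ if $\deg(A)$ is even and $\beta(A)=0$; $2$ if $\deg(A)$ is even and $\beta(A)\neq 0$; $3$ if $\deg(A)$ is odd and $\beta(A)=0$; $1$ if $\deg(A)$ is odd and $\beta(A)\neq 0$. A canvas $(\mathcal G,z)$ is a $\mathbb{Z}_3$-bordered graph with a distinguished vertex $z$. A tip preflow is an orientation $\psi$ of the edges incident with $z$ such that (counting in $\psi$) $\deg^+(z)-\deg^-(z)\equiv \beta(z)\pmod 3$; it extends to a nowhere-zero flow in $\mathcal G$ if some nowhere-zero flow agrees with $\psi$ on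 all edges incident with $z$. *)

theory Defs
  imports Complex_Main "HOL-Library.Numeral_Type"
begin

record ('v, 'e) mgraph =
  verts :: "'v set"
  edges :: "'e set"
  ends :: "'e \<Rightarrow> 'v set"

definition graph :: "('v, 'e) mgraph \<Rightarrow> bool" where
  "graph G \<longleftrightarrow> finite (verts G) \<and> finite (edges G) \<and>
     (\<forall>e\<in>edges G. ends G e \<subseteq> verts G \<and> card (ends G e) = 2)"

definition adjacency :: "('v, 'e) mgraph \<Rightarrow> ('v \<times> 'v) set" where
  "adjacency G = {(u, v). \<exists>e\<in>edges G. ends G e = {u, v}}"

definition components :: "('v, 'e) mgraph \<Rightarrow> 'v set set" where
  "components G = {{v \<in> verts G. (u, v) \<in> (adjacency G)\<^sup>*} | u. u \<in> verts G}"

text \<open>The numeral type \<^typ>\<open>3\<close> is the ring of integers modulo 3.\<close>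

definition Z3_boundary :: "('v, 'e) mgraph \<Rightarrow> ('v \<Rightarrow> 3) \<Rightarrow> bool" where
  "Z3_boundary G \<beta> \<longleftrightarrow> (\<forall>C\<in>components G. (\<Sum>v\<in>C. \<beta> v) = 0)"

definition canvas :: "('v, 'e) mgraph \<Rightarrow> ('v \<Rightarrow> 3) \<Rightarrow> 'v \<Rightarrow> bool" where
  "canvas G \<beta> z \<longleftrightarrow> graph G \<and> Z3_boundary G \<beta> \<and> z \<in> verts G"

definition deg :: "('v, 'e) mgraph \<Rightarrow> 'v set \<Rightarrow> nat" where
  "deg G A = card {e \<in> edges G. card (ends G e \<inter> A) = 1}"

definition incident_edges :: "('v, 'e) mgraph \<Rightarrow> 'v \<Rightarrow> 'e set" where
  "incident_edges G v = {e \<in> edges G. v \<in> ends G e}"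

definition vdeg :: "('v, 'e) mgraph \<Rightarrow> 'v \<Rightarrow> nat" where
  "vdeg G v = card (incident_edges G v)"

definition abs_tau :: "('v, 'e) mgraph \<Rightarrow> ('v \<Rightarrow> 3) \<Rightarrow> 'v set \<Rightarrow> nat" where
  "abs_tau G \<beta> A =
     (if even (deg G A) then (if (\<Sum>v\<in>A. \<beta> v) = 0 then 0 else 2)
      else (if (\<Sum>v\<in>A. \<beta> v) = 0 then 3 else 1))"

text \<open>An orientation of the edges in \<open>F\<close> sends each of them to its pair (tail, head);
  its values outside \<open>F\<close> are irrelevant.\<close>

definition orientation_on :: "('v, 'e) mgraph \<Rightarrow> 'e set \<Rightarrow> ('e \<Rightarrow> 'v \<times> 'v) \<Rightarrow> bool" where
  "orientation_on G F D \<longleftrightarrow> (\<forall>e\<in>F. {fst (D e), snd (D e)} = ends G e)"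

definition outdeg :: "'e set \<Rightarrow> ('e \<Rightarrow> 'v \<times> 'v) \<Rightarrow> 'v \<Rightarrow> nat" where
  "outdeg F D v = card {e \<in> F. fst (D e) = v}"

definition indeg :: "'e set \<Rightarrow> ('e \<Rightarrow> 'v \<times> 'v) \<Rightarrow> 'v \<Rightarrow> nat" where
  "indeg F D v = card {e \<in> F. snd (D e) = v}"

definition nowhere_zero_flow ::
  "('v, 'e) mgraph \<Rightarrow> ('v \<Rightarrow> 3) \<Rightarrow> ('e \<Rightarrow> 'v \<times> 'v) \<Rightarrow> bool" where
  "nowhere_zero_flow G \<beta> \<phi> \<longleftrightarrow> orientation_on G (edges G) \<phi> \<and>
     (\<forall>v\<in>verts G. of_nat (outdeg (edges G) \<phi> v) - of_nat (indeg (edges G) \<phi> v) = \<beta> v)"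

definition tip_preflow ::
  "('v, 'e) mgraph \<Rightarrow> ('v \<Rightarrow> 3) \<Rightarrow> 'v \<Rightarrow> ('e \<Rightarrow> 'v \<times> 'v) \<Rightarrow> bool" where
  "tip_preflow G \<beta> z \<psi> \<longleftrightarrow> orientation_on G (incident_edges G z) \<psi> \<and>
     of_nat (outdeg (incident_edges G z) \<psi> z) - of_nat (indeg (incident_edges G z) \<psi> z) = \<beta> z"

definition extends_to_flow ::
  "('v, 'e) mgraph \<Rightarrow> ('v \<Rightarrow> 3) \<Rightarrow> 'v \<Rightarrow> ('e \<Rightarrow> 'v \<times> 'v) \<Rightarrow> bool" where
  "extends_to_flow G \<beta> z \<psi> \<longleftrightarrow>
     (\<exists>\<phi>. nowhere_zero_flow G \<beta> \<phi> \<and> (\<forall>e\<in>incident_edges G z. \<phi> e = \<psi> e))"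

end

theory Submission
  imports Defs
begin

text \<open>
  Forget the tip \<open>z\<close>: of its pre-oriented edges keep only, at every other vertex, how many enter and
  how many leave it. What remains is an orientation problem on \<open>G - z\<close> with prescribed boundary
  modulo 3, and deleting or reversing an edge at \<open>z\<close> does not change that problem, it only changes
  the certificate \<open>deg A \<ge> 4 + |\<tau>(A)|\<close>, which just says that \<open>deg A \<ge> 4\<close>, with \<open>\<beta>(A) = 0\<close> if
  \<open>deg A = 4\<close> and \<open>\<beta>(A) \<noteq> 0\<close> if \<open>deg A = 5\<close>.

  For the induction the hypothesis on \<open>x\<close> is weakened: if \<open>deg z = 7\<close>, two vertices \<open>x\<close>, \<open>y\<close> also
  suffice such that sets containing one of them have degree at least 5 and sets containing both have
  degree at least 6. Take a minimal counterexample. Contracting a set \<open>A\<close> and then its complement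
  shows that all sets with at least two vertices have large degree; parallel edges away from \<open>z\<close>
  can be contracted; a vertex of degree 4 can be split off. So all vertices have degree at least 5
  and larger sets have degree at least 8. Now pick an edge from \<open>z\<close> to \<open>v\<close> (or, symmetrically,
  from \<open>v\<close> to \<open>z\<close>). If it cannot be deleted, then \<open>v\<close> has degree 5 and \<open>\<beta>(v) = 1\<close>, or degree 6 and
  \<open>\<beta>(v) = -1\<close>; if no edge from \<open>v\<close> can be deleted after orienting it away from \<open>v\<close>, then all
  neighbours of \<open>v\<close> are of this kind too. In degree 6 we reverse the edge from \<open>z\<close> and delete an edge
  oriented towards \<open>v\<close>; in degree 5 we orient all five edges towards \<open>v\<close> and delete \<open>v\<close>.
\<close>

subsection \<open>Nets\<close>

text \<open>A graph without its tip: \<open>tip_in v\<close> and \<open>tip_out v\<close> count the tip edges into and out of \<open>v\<close>,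
  and \<open>demand v\<close> is the boundary modulo 3 that remains after their removal, so that
  \<open>demand v - tip_in v + tip_out v\<close> represents \<open>\<beta>(v)\<close>. A flow ignores the tip edges; they only enter
  degrees and borders. Loops are allowed, which makes contraction a mere relabelling of ends.\<close>

record ('v, 'e) net =
  nodes :: "'v set"
  arcs :: "'e set"
  tail :: "'e \<Rightarrow> 'v"
  head :: "'e \<Rightarrow> 'v"
  tip_in :: "'v \<Rightarrow> nat"
  tip_out :: "'v \<Rightarrow> nat"
  demand :: "'v \<Rightarrow> int"

definition wf_net :: "('v, 'e) net \<Rightarrow> bool" where
  "wf_net N \<longleftrightarrow> finite (nodes N) \<and> finite (arcs N) \<and>
     (\<forall>e\<in>arcs N. tail N e \<in> nodes N \<and> head N e \<in> nodes N) \<and> 3 dvd (\<Sum>v\<in>nodes N. demand N v)"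

definition tips :: "('v, 'e) net \<Rightarrow> 'v \<Rightarrow> nat" where
  "tips N v = tip_in N v + tip_out N v"

definition cut_arcs :: "('v, 'e) net \<Rightarrow> 'v set \<Rightarrow> 'e set" where
  "cut_arcs N X = {e \<in> arcs N. (tail N e \<in> X) \<noteq> (head N e \<in> X)}"

definition inner_arcs :: "('v, 'e) net \<Rightarrow> 'v set \<Rightarrow> 'e set" where
  "inner_arcs N X = {e \<in> arcs N. tail N e \<in> X \<and> head N e \<in> X}"

definition degree :: "('v, 'e) net \<Rightarrow> 'v set \<Rightarrow> nat" where
  "degree N X = card (cut_arcs N X) + (\<Sum>v\<in>X. tips N v)"

definition border :: "('v, 'e) net \<Rightarrow> 'v set \<Rightarrow> int" where
  "border N X = (\<Sum>v\<in>X. demand N v - int (tip_in N v) + int (tip_out N v))"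

definition incidence :: "('v, 'e) net \<Rightarrow> 'e \<Rightarrow> 'v set \<Rightarrow> int" where
  "incidence N e X = of_bool (tail N e \<in> X) - of_bool (head N e \<in> X)"

definition surplus :: "('v, 'e) net \<Rightarrow> ('e \<Rightarrow> int) \<Rightarrow> 'v set \<Rightarrow> int" where
  "surplus N f X = (\<Sum>e\<in>arcs N. f e * incidence N e X) - (\<Sum>v\<in>X. demand N v)"

definition signing :: "'e set \<Rightarrow> ('e \<Rightarrow> int) \<Rightarrow> bool" where
  "signing F f \<longleftrightarrow> (\<forall>e\<in>F. f e = 1 \<or> f e = -1)"

definition flow :: "('v, 'e) net \<Rightarrow> ('e \<Rightarrow> int) \<Rightarrow> bool" where
  "flow N f \<longleftrightarrow> signing (arcs N) f \<and> (\<forall>v\<in>nodes N. 3 dvd surplus N f {v})"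

lemma wf_netD:
  assumes "wf_net N"
  shows "finite (nodes N)" "finite (arcs N)"
    and "e \<in> arcs N \<Longrightarrow> tail N e \<in> nodes N" "e \<in> arcs N \<Longrightarrow> head N e \<in> nodes N"
    and "3 dvd (\<Sum>v\<in>nodes N. demand N v)"
  using assms by (auto simp: wf_net_def)

lemma finite_cut_arcs: "finite (arcs N) \<Longrightarrow> finite (cut_arcs N X)"
  by (simp add: cut_arcs_def)

lemma cut_arcs_Un_disjoint: "X \<inter> Y = {} \<Longrightarrow> cut_arcs N (X \<union> Y) =
    sym_diff (cut_arcs N X) (cut_arcs N Y)"
  by (auto simp: cut_arcs_def)

lemma cut_arcs_complement: "wf_net N \<Longrightarrow> cut_arcs N (nodes N - X) = cut_arcs N X"
  by (auto simp: cut_arcs_def wf_net_def)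

lemma card_sym_diff:
  assumes "finite A" "finite B"
  shows "card (sym_diff A B) + 2 * card (A \<inter> B) = card A + card B"
proof -
  have "card (sym_diff A B) = card (A - B) + card (B - A)"
    using assms by (intro card_Un_disjoint) auto
  then show ?thesis
    using card_Int_Diff[OF assms(1), of B] card_Int_Diff[OF assms(2), of A]
    by (simp add: Int_commute)
qed

lemma degree_Un_disjoint:
  assumes "finite (arcs N)" "finite X" "finite Y" "X \<inter> Y = {}"
  shows "degree N (X \<union> Y) + 2 * card (cut_arcs N X \<inter> cut_arcs N Y) = degree N X + degree N Y"
  using assms card_sym_diff[of "cut_arcs N X" "cut_arcs N Y"]
  by (simp add: degree_def cut_arcs_Un_disjoint finite_cut_arcs sum.union_disjoint)

lemma degree_insert:
  assumes "finite (arcs N)" "finite X" "v \<notin> X"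
  shows "degree N (insert v X) + 2 * card (cut_arcs N X \<inter> cut_arcs N {v}) =
      degree N X + degree N {v}"
  using degree_Un_disjoint[of N X "{v}"] assms by simp

lemma degree_empty [simp]: "degree N {} = 0"
  by (simp add: degree_def cut_arcs_def)

lemma even_degree_iff:
  assumes "finite (arcs N)" "finite X"
  shows "even (degree N X) \<longleftrightarrow> even (\<Sum>v\<in>X. degree N {v})"
  using assms(2)
proof (induction X rule: finite_induct)
  case (insert v X)
  from degree_insert[OF assms(1) insert.hyps]
  have "even (degree N (insert v X)) = even (degree N X + degree N {v})"
    by presburger
  then show ?case using insert by auto
qed simp

lemma degree_nodes: "wf_net N \<Longrightarrow> degree N (nodes N) = (\<Sum>v\<in>nodes N. tips N v)"
  by (auto simp: degree_def cut_arcs_def wf_net_def)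

lemma degree_remove_node:
  assumes "wf_net N" "v \<in> nodes N"
  shows "degree N (nodes N - {v}) + 2 * tips N v = degree N (nodes N) + degree N {v}"
  using assms cut_arcs_complement[of N "{v}"] sum.remove[of "nodes N" v "tips N"]
  by (simp add: degree_nodes wf_netD) (simp add: degree_def)

lemma border_eq_sum: "border N X = (\<Sum>v\<in>X. border N {v})"
  by (simp add: border_def)

lemma incidence_eq_sum:
  assumes "finite X"
  shows "incidence N e X = (\<Sum>v\<in>X. incidence N e {v})"
proof -
  have "(\<Sum>v\<in>X. of_bool (w = v) :: int) = of_bool (w \<in> X)" for w
    using assms by (auto simp: of_bool_def sum.delta')
  then show ?thesis by (simp add: incidence_def sum_subtractf)
qed

lemma surplus_eq_sum:
  assumes "finite X"
  shows "surplus N f X = (\<Sum>v\<in>X. surplus N f {v})"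
proof -
  have "(\<Sum>e\<in>arcs N. f e * incidence N e X) = (\<Sum>v\<in>X. \<Sum>e\<in>arcs N. f e * incidence N e {v})"
    by (subst sum.swap) (simp add: incidence_eq_sum[OF assms] sum_distrib_left)
  then show ?thesis by (simp add: surplus_def sum_subtractf)
qed

lemma surplus_nodes_dvd:
  assumes "wf_net N"
  shows "3 dvd surplus N f (nodes N)"
proof -
  have "(\<Sum>e\<in>arcs N. f e * incidence N e (nodes N)) = 0"
    using assms by (intro sum.neutral) (auto simp: incidence_def wf_net_def)
  then show ?thesis using wf_netD(5)[OF assms] by (simp add: surplus_def)
qed

lemma surplus_cong:
  assumes "\<And>e. e \<in> arcs N \<Longrightarrow> incidence N e X \<noteq> 0 \<Longrightarrow> f e = g e"
  shows "surplus N f X = surplus N g X"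
proof -
  have "f e * incidence N e X = g e * incidence N e X" if "e \<in> arcs N" for e
    using assms[OF that] by (cases "incidence N e X = 0") simp_all
  then show ?thesis unfolding surplus_def by (simp only: cong: sum.cong)
qed

lemma surplus_subset_diff:
  assumes "finite Y" "X \<subseteq> Y"
  shows "surplus N f Y = surplus N f (Y - X) + surplus N f X"
  using sum.subset_diff[OF assms(2,1), of "\<lambda>v. surplus N f {v}"] assms
    surplus_eq_sum[of Y N f] surplus_eq_sum[of X N f] surplus_eq_sum[of "Y - X" N f]
  by (simp add: finite_subset)

lemma dvd_surplus:
  assumes "finite X" "\<And>v. v \<in> X \<Longrightarrow> d dvd surplus N f {v}"
  shows "d dvd surplus N f X"
  unfolding surplus_eq_sum[OF assms(1)] using assms(2) by (rule dvd_sum)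

lemma flow_single_node:
  assumes "wf_net N" "nodes N = {v}"
  shows "flow N (\<lambda>_. 1)"
  using surplus_nodes_dvd[OF assms(1)] assms(2) by (simp add: flow_def signing_def)

subsection \<open>Admissible nets\<close>

text \<open>The condition \<open>d \<ge> 4 + |\<tau>|\<close> for a set of degree \<open>d\<close> and border \<open>b\<close>.\<close>

definition ample :: "nat \<Rightarrow> int \<Rightarrow> bool" where
  "ample d b \<longleftrightarrow> 4 \<le> d \<and> (d = 4 \<longrightarrow> 3 dvd b) \<and> (d = 5 \<longrightarrow> \<not> 3 dvd b)"

definition ample_net :: "('v, 'e) net \<Rightarrow> bool" where
  "ample_net N \<longleftrightarrow> (\<forall>X. X \<noteq> {} \<and> X \<subset> nodes N \<longrightarrow> ample (degree N X) (border N X))"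

definition anchor :: "('v, 'e) net \<Rightarrow> 'v set \<Rightarrow> 'v \<Rightarrow> bool" where
  "anchor N A x \<longleftrightarrow> x \<in> A \<and> (\<forall>X\<subseteq>A. x \<in> X \<longrightarrow> degree N A \<le> degree N X + 1)"

definition twin_anchors :: "('v, 'e) net \<Rightarrow> 'v set \<Rightarrow> 'v \<Rightarrow> 'v \<Rightarrow> bool" where
  "twin_anchors N A x y \<longleftrightarrow> degree N A = 7 \<and> x \<in> A \<and> y \<in> A \<and> x \<noteq> y \<and>
     (\<forall>X\<subseteq>A. (x \<in> X \<or> y \<in> X \<longrightarrow> 5 \<le> degree N X) \<and> (x \<in> X \<and> y \<in> X \<longrightarrow> 6 \<le> degree N X))"

definition anchored :: "('v, 'e) net \<Rightarrow> 'v set \<Rightarrow> bool" where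
  "anchored N A \<longleftrightarrow> (\<exists>x. anchor N A x) \<or> (\<exists>x y. twin_anchors N A x y)"

definition admissible :: "('v, 'e) net \<Rightarrow> bool" where
  "admissible N \<longleftrightarrow> wf_net N \<and> ample_net N \<and> anchored N (nodes N)"

lemma ample_ge_4: "ample d b \<Longrightarrow> 4 \<le> d"
  by (simp add: ample_def)

lemma ample_if_ge_6: "6 \<le> d \<Longrightarrow> ample d b"
  by (simp add: ample_def)

lemma ample_uminus [simp]: "ample d (- b) = ample d b"
  by (simp add: ample_def)

lemma ample_add_multiple: "3 dvd c \<Longrightarrow> ample d (c + b) = ample d b"
  by (simp add: ample_def dvd_add_right_iff)

lemma ample_netD: "ample_net N \<Longrightarrow> X \<noteq> {} \<Longrightarrow> X \<subset> nodes N \<Longrightarrow> ample (degree N X) (border N X)"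
  by (simp add: ample_net_def)

lemma degree_ge_4_if_ample_net: "ample_net N \<Longrightarrow> X \<noteq> {} \<Longrightarrow> X \<subset> nodes N \<Longrightarrow> 4 \<le> degree N X"
  using ample_netD ample_ge_4 by blast

lemma anchorI:
  "x \<in> A \<Longrightarrow> (\<And>X. X \<subset> A \<Longrightarrow> x \<in> X \<Longrightarrow> degree N A \<le> degree N X + 1) \<Longrightarrow> anchor N A x"
  unfolding anchor_def by (metis le_add1 psubsetI)

lemma anchorD:
  assumes "anchor N A x"
  shows "x \<in> A" "X \<subseteq> A \<Longrightarrow> x \<in> X \<Longrightarrow> degree N A \<le> degree N X + 1"
  using assms by (auto simp: anchor_def)

lemma twin_anchorsD:
  assumes "twin_anchors N A x y"
  shows "degree N A = 7" "x \<in> A" "y \<in> A" "x \<noteq> y"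
    and "X \<subseteq> A \<Longrightarrow> x \<in> X \<or> y \<in> X \<Longrightarrow> 5 \<le> degree N X"
    and "X \<subseteq> A \<Longrightarrow> x \<in> X \<Longrightarrow> y \<in> X \<Longrightarrow> 6 \<le> degree N X"
  using assms by (auto simp: twin_anchors_def)

lemma anchored_if_anchor: "anchor N A x \<Longrightarrow> anchored N A"
  and anchored_if_twin_anchors: "twin_anchors N A x y \<Longrightarrow> anchored N A"
  by (auto simp: anchored_def)

lemma anchoredE [consumes 1, case_names anchor twin_anchors]:
  assumes "anchored N A"
  obtains x where "anchor N A x" | x y where "twin_anchors N A x y"
  using assms by (auto simp: anchored_def)

lemma anchored_cong:
  "(\<And>X. X \<subseteq> A \<Longrightarrow> degree M X = degree N X) \<Longrightarrow> anchored M A = anchored N A"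
  by (simp add: anchored_def anchor_def twin_anchors_def cong: conj_cong)

lemma eq_singleton_or_card_ge_2:
  assumes "finite X" "x \<in> X"
  shows "X = {x} \<or> 2 \<le> card X"
proof (cases "X = {x}")
  case False
  then have "card {x} < card X" using assms by (intro psubset_card_mono) auto
  then show ?thesis by simp
qed simp

lemma anchored_if_degree_le_5:
  assumes "A \<noteq> {}" "degree N A \<le> 5"
    and ge_4: "\<And>X. X \<noteq> {} \<Longrightarrow> X \<subset> A \<Longrightarrow> 4 \<le> degree N X"
  shows "anchored N A"
proof -
  obtain x where "x \<in> A" using assms(1) by blast
  moreover have "degree N A \<le> degree N X + 1" if "X \<subset> A" "x \<in> X" for X
  proof -
    have "4 \<le> degree N X" using that by (intro ge_4) auto
    then show ?thesis using assms(2) by simp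
  qed
  ultimately have "anchor N A x" by (rule anchorI)
  then show ?thesis by (rule anchored_if_anchor)
qed

context
  fixes N :: "('v, 'e) net" and A :: "'v set"
  assumes finite: "finite A"
    and ge_6: "\<And>X. X \<subset> A \<Longrightarrow> 2 \<le> card X \<Longrightarrow> 6 \<le> degree N X"
begin

private lemma subset_cases:
  assumes "X \<subseteq> A" "x \<in> X"
  shows "X = A \<or> X = {x} \<or> 6 \<le> degree N X"
  using eq_singleton_or_card_ge_2[OF finite_subset[OF assms(1) finite] assms(2)] ge_6[of X] assms(1)
  by auto

lemma anchor_if_degree_le_7:
  assumes "x \<in> A" "degree N A \<le> degree N {x} + 1" "degree N A \<le> 7"
  shows "anchor N A x"
proof (rule anchorI[OF assms(1)])
  fix X assume "X \<subset> A" "x \<in> X"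
  then show "degree N A \<le> degree N X + 1"
    using subset_cases[of X x] assms(2,3) by auto
qed

lemma twin_anchors_if_degree_7:
  assumes deg: "degree N A = 7" and xy: "x \<in> A" "y \<in> A" "x \<noteq> y"
    and ge_5: "5 \<le> degree N {x}" "5 \<le> degree N {y}"
  shows "twin_anchors N A x y"
proof -
  have "5 \<le> degree N X" if "X \<subseteq> A" "x \<in> X \<or> y \<in> X" for X
    using that(2) subset_cases[OF that(1), of x] subset_cases[OF that(1), of y] ge_5 deg by auto
  moreover have "6 \<le> degree N X" if "X \<subseteq> A" "x \<in> X" "y \<in> X" for X
    using subset_cases[OF that(1,2)] that(3) xy(3) deg by auto
  ultimately show ?thesis unfolding twin_anchors_def using deg xy by blast
qed

end

lemma anchored_if_degree_le_7:
  assumes nodes: "finite (nodes N)" "nodes N \<noteq> {}" and ample: "ample_net N"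
    and small: "degree N (nodes N) \<le> 7"
    and ge_6: "\<And>X. X \<subset> nodes N \<Longrightarrow> 2 \<le> card X \<Longrightarrow> 6 \<le> degree N X"
    and deg_6: "degree N (nodes N) = 6 \<Longrightarrow> \<exists>x\<in>nodes N. 5 \<le> degree N {x}"
    and deg_7: "degree N (nodes N) = 7 \<Longrightarrow>
      \<exists>x\<in>nodes N. \<exists>y\<in>nodes N. x \<noteq> y \<and> 5 \<le> degree N {x} \<and> 5 \<le> degree N {y}"
  shows "anchored N (nodes N)"
proof -
  consider (le_5) "degree N (nodes N) \<le> 5" | (eq_6) "degree N (nodes N) = 6"
    | (eq_7) "degree N (nodes N) = 7"
    using small by linarith
  then show ?thesis
  proof cases
    case le_5
    show ?thesis
      by (rule anchored_if_degree_le_5[OF nodes(2) le_5 degree_ge_4_if_ample_net[OF ample]])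
  next
    case eq_6
    then obtain x where "x \<in> nodes N" "5 \<le> degree N {x}" using deg_6 by blast
    then have "anchor N (nodes N) x" using eq_6 ge_6 by (intro anchor_if_degree_le_7 nodes(1)) auto
    then show ?thesis by (rule anchored_if_anchor)
  next
    case eq_7
    then obtain x y where "x \<in> nodes N" "y \<in> nodes N" "x \<noteq> y" "5 \<le> degree N {x}" "5 \<le> degree N {y}"
      using deg_7 by blast
    then have "twin_anchors N (nodes N) x y"
      using eq_7 ge_6 by (intro twin_anchors_if_degree_7 nodes(1)) auto
    then show ?thesis by (rule anchored_if_twin_anchors)
  qed
qed

lemma ample_netI:
  assumes "finite (nodes N)"
    and single: "\<And>v. v \<in> nodes N \<Longrightarrow> nodes N \<noteq> {v} \<Longrightarrow> ample (degree N {v}) (border N {v})"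
    and ge_6: "\<And>X. X \<subset> nodes N \<Longrightarrow> 2 \<le> card X \<Longrightarrow> 6 \<le> degree N X"
  shows "ample_net N"
  unfolding ample_net_def
proof (intro allI impI, elim conjE)
  fix X assume X: "X \<noteq> {}" "X \<subset> nodes N"
  then obtain x where x: "x \<in> X" by blast
  have "finite X" using X(2) assms(1) finite_subset by blast
  from eq_singleton_or_card_ge_2[OF this x] show "ample (degree N X) (border N X)"
  proof
    assume "X = {x}"
    then show ?thesis using single[of x] X by auto
  next
    assume "2 \<le> card X"
    then show ?thesis using ge_6[OF X(2)] ample_if_ge_6 by blast
  qed
qed

lemma admissible_transfer:
  assumes "admissible N" "wf_net M" "nodes M = nodes N" "\<And>X. degree M X = degree N X"
    "\<And>X. border M X = border N X \<or> border M X = - border N X"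
  shows "admissible M"
proof -
  have "ample (degree M X) (border M X) = ample (degree N X) (border N X)" for X
    using assms(4)[of X] assms(5)[of X] by auto
  then show ?thesis
    using assms anchored_cong[of "nodes N" M N] by (simp add: admissible_def ample_net_def)
qed

subsection \<open>Quotients\<close>

definition quotient_net :: "('v \<Rightarrow> 'w) \<Rightarrow> ('v, 'e) net \<Rightarrow> ('w, 'e) net" where
  "quotient_net r N = \<lparr>nodes = r ` nodes N, arcs = arcs N, tail = r \<circ> tail N, head = r \<circ> head N,
     tip_in = (\<lambda>u. \<Sum>v | v \<in> nodes N \<and> r v = u. tip_in N v),
     tip_out = (\<lambda>u. \<Sum>v | v \<in> nodes N \<and> r v = u. tip_out N v),
     demand = (\<lambda>u. \<Sum>v | v \<in> nodes N \<and> r v = u. demand N v)\<rparr>"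

definition preimage_nodes :: "('v \<Rightarrow> 'w) \<Rightarrow> ('v, 'e) net \<Rightarrow> 'w set \<Rightarrow> 'v set" where
  "preimage_nodes r N X = {v \<in> nodes N. r v \<in> X}"

lemma sum_fibres:
  assumes "finite (nodes N)" "X \<subseteq> r ` nodes N"
  shows "(\<Sum>u\<in>X. \<Sum>v | v \<in> nodes N \<and> r v = u. g v) = (\<Sum>v\<in>preimage_nodes r N X. g v)"
proof -
  have "{v \<in> preimage_nodes r N X. r v = u} = {v \<in> nodes N. r v = u}" if "u \<in> X" for u
    using that by (auto simp: preimage_nodes_def)
  moreover have "(\<Sum>u\<in>X. \<Sum>v | v \<in> preimage_nodes r N X \<and> r v = u. g v) =
      (\<Sum>v\<in>preimage_nodes r N X. g v)"
    using assms by (intro sum.group) (auto simp: preimage_nodes_def intro: finite_subset)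
  ultimately show ?thesis by simp
qed

lemma preimage_nodes_subset: "preimage_nodes r N X \<subseteq> nodes N"
  by (auto simp: preimage_nodes_def)

lemma preimage_nodes_image: "preimage_nodes r N (r ` nodes N) = nodes N"
  by (auto simp: preimage_nodes_def)

lemma preimage_nodes_proper:
  "X \<noteq> {} \<Longrightarrow> X \<subset> r ` nodes N \<Longrightarrow> preimage_nodes r N X \<noteq> {} \<and> preimage_nodes r N X \<subset> nodes N"
  by (auto simp: preimage_nodes_def)

lemma nodes_quotient_net [simp]: "nodes (quotient_net r N) = r ` nodes N"
  and arcs_quotient_net [simp]: "arcs (quotient_net r N) = arcs N"
  by (simp_all add: quotient_net_def)

lemma wf_quotient_net:
  assumes "wf_net N"
  shows "wf_net (quotient_net r N)"
  using assms sum_fibres[of N "r ` nodes N" r "demand N"]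
  by (auto simp: wf_net_def quotient_net_def preimage_nodes_image)

context
  fixes N :: "('v, 'e) net" and r :: "'v \<Rightarrow> 'w" and X :: "'w set"
  assumes wf: "wf_net N" and X: "X \<subseteq> r ` nodes N"
begin

private lemma fibres:
  "(\<Sum>u\<in>X. \<Sum>v | v \<in> nodes N \<and> r v = u. g v) = (\<Sum>v\<in>preimage_nodes r N X. g v)"
  for g :: "'v \<Rightarrow> 'c::comm_monoid_add"
  using sum_fibres[OF wf_netD(1)[OF wf] X] .

lemma degree_quotient_net: "degree (quotient_net r N) X = degree N (preimage_nodes r N X)"
proof -
  have "cut_arcs (quotient_net r N) X = cut_arcs N (preimage_nodes r N X)"
    using wf by (auto simp: cut_arcs_def quotient_net_def preimage_nodes_def wf_net_def)
  then show ?thesis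
    by (simp add: degree_def tips_def sum.distrib) (simp add: quotient_net_def fibres)
qed

lemma border_quotient_net: "border (quotient_net r N) X = border N (preimage_nodes r N X)"
  unfolding border_def sum.distrib sum_subtractf
  by (simp add: quotient_net_def fibres flip: of_nat_sum)

lemma surplus_quotient_net: "surplus (quotient_net r N) f X = surplus N f (preimage_nodes r N X)"
proof -
  have "incidence (quotient_net r N) e X = incidence N e (preimage_nodes r N X)"
    if "e \<in> arcs N" for e
    using that wf by (auto simp: incidence_def quotient_net_def preimage_nodes_def wf_net_def)
  then show ?thesis by (simp add: surplus_def) (simp add: quotient_net_def fibres)
qed

end

lemma anchored_quotient_net:
  assumes wf: "wf_net N" and anchored: "anchored N (nodes N)"
  shows "anchored (quotient_net r N) (r ` nodes N)"
proof -
  note degree = degree_quotient_net[OF wf]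
  have total: "degree (quotient_net r N) (r ` nodes N) = degree N (nodes N)"
    by (simp add: degree preimage_nodes_image)
  have mem: "v \<in> preimage_nodes r N X" if "v \<in> nodes N" "r v \<in> X" for v X
    using that by (simp add: preimage_nodes_def)
  from anchored show ?thesis
  proof (cases rule: anchoredE)
    case (anchor x)
    then have "anchor (quotient_net r N) (r ` nodes N) (r x)"
      unfolding anchor_def total by (simp add: degree mem preimage_nodes_subset)
    then show ?thesis by (rule anchored_if_anchor)
  next
    case (twin_anchors x y)
    note twin = twin_anchorsD[OF this]
    show ?thesis
    proof (cases "r x = r y")
      case True
      then have "6 \<le> degree N (preimage_nodes r N X)" if "r x \<in> X" for X
        using twin that by (intro twin(6)) (simp_all add: mem preimage_nodes_subset)
      then have "anchor (quotient_net r N) (r ` nodes N) (r x)"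
        unfolding anchor_def total using twin by (simp add: degree)
      then show ?thesis by (rule anchored_if_anchor)
    next
      case False
      then have "twin_anchors (quotient_net r N) (r ` nodes N) (r x) (r y)"
        unfolding twin_anchors_def total using twin by (auto simp: degree mem preimage_nodes_subset)
      then show ?thesis by (rule anchored_if_twin_anchors)
    qed
  qed
qed

lemma admissible_quotient_net:
  assumes "admissible N"
  shows "admissible (quotient_net r N)"
proof -
  have wf: "wf_net N" and ample: "ample_net N" and anchored: "anchored N (nodes N)"
    using assms by (auto simp: admissible_def)
  have "ample_net (quotient_net r N)"
    unfolding ample_net_def nodes_quotient_net
  proof (intro allI impI, elim conjE)
    fix X assume X: "X \<noteq> {}" "X \<subset> r ` nodes N"
    then show "ample (degree (quotient_net r N) X) (border (quotient_net r N) X)"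
      using ample_netD[OF ample] preimage_nodes_proper[OF X]
      by (simp add: degree_quotient_net[OF wf] border_quotient_net[OF wf] psubset_imp_subset)
  qed
  then show ?thesis
    using wf_quotient_net[OF wf, of r] anchored_quotient_net[OF wf anchored, of r]
    by (simp add: admissible_def)
qed

subsection \<open>Subnets and restrictions\<close>

definition flow_outside :: "('v, 'e) net \<Rightarrow> 'v set \<Rightarrow> ('e \<Rightarrow> int) \<Rightarrow> bool" where
  "flow_outside N A s \<longleftrightarrow> signing (arcs N) s \<and> (\<forall>v\<in>nodes N - A. 3 dvd surplus N s {v})"

text \<open>The arcs outside \<open>K\<close> are deleted after they have been signed by \<open>s\<close>.\<close>

definition subnet :: "('v, 'e) net \<Rightarrow> 'v set \<Rightarrow> 'e set \<Rightarrow> ('e \<Rightarrow> int) \<Rightarrow> ('v, 'e) net" where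
  "subnet N A K s = N\<lparr>nodes := A, arcs := K,
     demand := (\<lambda>v. demand N v - (\<Sum>e\<in>arcs N - K. s e * incidence N e {v}))\<rparr>"

definition new_tips :: "('v, 'e) net \<Rightarrow> 'v set \<Rightarrow> ('e \<Rightarrow> int) \<Rightarrow> int \<Rightarrow> 'v \<Rightarrow> 'e set" where
  "new_tips N A s c v = {e \<in> arcs N - inner_arcs N A. s e * incidence N e {v} = c}"

definition restrict_net :: "('v, 'e) net \<Rightarrow> 'v set \<Rightarrow> ('e \<Rightarrow> int) \<Rightarrow> ('v, 'e) net" where
  "restrict_net N A s = (subnet N A (inner_arcs N A) s)
     \<lparr>tip_in := (\<lambda>v. tip_in N v + card (new_tips N A s (-1) v)),
      tip_out := (\<lambda>v. tip_out N v + card (new_tips N A s 1 v))\<rparr>"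

lemma subnet_simps [simp]:
  "nodes (subnet N A K s) = A" "arcs (subnet N A K s) = K"
  "tail (subnet N A K s) = tail N" "head (subnet N A K s) = head N"
  "tip_in (subnet N A K s) = tip_in N" "tip_out (subnet N A K s) = tip_out N"
  by (simp_all add: subnet_def)

lemma inner_arcs_subset: "inner_arcs N A \<subseteq> arcs N"
  by (auto simp: inner_arcs_def)

lemma incidence_subnet [simp]: "incidence (subnet N A K s) = incidence N"
  by (simp add: incidence_def fun_eq_iff)

lemma surplus_subnet:
  assumes "finite (arcs N)" "K \<subseteq> arcs N" "finite X"
  shows "surplus (subnet N A K s) g X = surplus N (\<lambda>e. if e \<in> K then g e else s e) X"
proof -
  let ?h = "\<lambda>e. if e \<in> K then g e else s e"
  have "(\<Sum>v\<in>X. \<Sum>e\<in>arcs N - K. s e * incidence N e {v}) = (\<Sum>e\<in>arcs N - K. s e * incidence N e X)"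
    by (subst sum.swap) (simp add: incidence_eq_sum[OF assms(3)] sum_distrib_left)
  moreover have "(\<Sum>e\<in>arcs N. ?h e * incidence N e X) =
      (\<Sum>e\<in>arcs N - K. s e * incidence N e X) + (\<Sum>e\<in>K. g e * incidence N e X)"
    using assms by (simp add: sum.subset_diff[of K "arcs N"])
  ultimately show ?thesis by (simp add: surplus_def subnet_def sum_subtractf incidence_def)
qed

lemma degree_subnet:
  assumes "finite (arcs N)" "K \<subseteq> arcs N"
  shows "degree (subnet N A K s) X + card (cut_arcs N X - K) = degree N X"
proof -
  have "cut_arcs (subnet N A K s) X = cut_arcs N X \<inter> K"
    using assms(2) by (auto simp: cut_arcs_def)
  then show ?thesis
    using card_Int_Diff[OF finite_cut_arcs[OF assms(1)], of X K] by (simp add: degree_def tips_def)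
qed

lemma border_subnet:
  assumes "finite X"
  shows "border (subnet N A K s) X = border N X - (\<Sum>e\<in>arcs N - K. s e * incidence N e X)"
proof -
  have "(\<Sum>v\<in>X. \<Sum>e\<in>arcs N - K. s e * incidence N e {v}) = (\<Sum>e\<in>arcs N - K. s e * incidence N e X)"
    by (subst sum.swap) (simp add: incidence_eq_sum[OF assms] sum_distrib_left)
  then show ?thesis by (simp add: border_def subnet_def sum_subtractf sum.distrib)
qed

lemma surplus_outside:
  assumes "K \<subseteq> inner_arcs N A" "v \<notin> A"
  shows "surplus N (\<lambda>e. if e \<in> K then g e else s e) {v} = surplus N s {v}"
proof (rule surplus_cong)
  fix e assume "e \<in> arcs N" "incidence N e {v} \<noteq> 0"
  then have "tail N e = v \<or> head N e = v" by (auto simp: incidence_def)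
  then have "e \<notin> K" using assms by (auto simp: inner_arcs_def)
  then show "(if e \<in> K then g e else s e) = s e" by simp
qed

lemma wf_subnet:
  assumes wf: "wf_net N" and A: "A \<subseteq> nodes N" and K: "K \<subseteq> inner_arcs N A"
    and s: "flow_outside N A s"
  shows "wf_net (subnet N A K s)"
proof -
  let ?M = "subnet N A K s" and ?h = "\<lambda>e. if e \<in> K then 0 else s e"
  have fin: "finite (nodes N)" "finite (arcs N)" "finite A"
    using wf A by (auto simp: wf_net_def intro: finite_subset)
  have K_arcs: "K \<subseteq> arcs N" by (rule subset_trans[OF K inner_arcs_subset])
  have "3 dvd surplus N ?h (nodes N - A)"
  proof (rule dvd_surplus)
    fix v assume v: "v \<in> nodes N - A"
    then have "surplus N ?h {v} = surplus N s {v}" by (intro surplus_outside[OF K]) simp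
    then show "3 dvd surplus N ?h {v}" using s v by (simp add: flow_outside_def)
  qed (use fin in simp)
  then have "3 dvd surplus N ?h A"
    using surplus_nodes_dvd[OF wf, of ?h]
    by (simp add: surplus_subset_diff[OF fin(1) A] dvd_add_right_iff)
  then have "3 dvd surplus ?M (\<lambda>_. 0) A"
    by (simp add: surplus_subnet[OF fin(2) K_arcs fin(3)])
  then have "3 dvd (\<Sum>v\<in>A. demand ?M v)" by (simp add: surplus_def)
  moreover have "tail N e \<in> A \<and> head N e \<in> A" if "e \<in> K" for e
    using that K by (auto simp: inner_arcs_def)
  moreover have "finite K" using K_arcs fin(2) finite_subset by blast
  ultimately show ?thesis using fin by (simp add: wf_net_def)
qed

lemma flow_if_subnet_flow:
  assumes wf: "wf_net N" and K: "K \<subseteq> inner_arcs N A" and s: "flow_outside N A s"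
    and g: "flow (subnet N A K s) g"
  shows "flow N (\<lambda>e. if e \<in> K then g e else s e)"
  unfolding flow_def
proof (intro conjI ballI)
  show "signing (arcs N) (\<lambda>e. if e \<in> K then g e else s e)"
    using s g by (simp add: signing_def flow_def flow_outside_def)
next
  fix v assume v: "v \<in> nodes N"
  have K_arcs: "K \<subseteq> arcs N" by (rule subset_trans[OF K inner_arcs_subset])
  show "3 dvd surplus N (\<lambda>e. if e \<in> K then g e else s e) {v}"
  proof (cases "v \<in> A")
    case True
    then have "3 dvd surplus (subnet N A K s) g {v}" using g by (simp add: flow_def)
    then show ?thesis by (simp add: surplus_subnet[OF wf_netD(2)[OF wf] K_arcs])
  next
    case False
    then show ?thesis
      unfolding surplus_outside[OF K False] using s v by (simp add: flow_outside_def)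
  qed
qed

lemma restrict_net_simps [simp]:
  "nodes (restrict_net N A s) = A" "arcs (restrict_net N A s) = inner_arcs N A"
  "tail (restrict_net N A s) = tail N" "head (restrict_net N A s) = head N"
  by (simp_all add: restrict_net_def)

lemma wf_restrict_net:
  assumes "wf_net N" "A \<subseteq> nodes N" "flow_outside N A s"
  shows "wf_net (restrict_net N A s)"
  using wf_subnet[OF assms(1,2) subset_refl assms(3)] by (simp add: wf_net_def restrict_net_def)

lemma flow_if_restrict_net_flow:
  assumes "wf_net N" "flow_outside N A s" "flow (restrict_net N A s) g"
  shows "\<exists>f. flow N f"
proof -
  have "flow (subnet N A (inner_arcs N A) s) g"
    using assms(3) by (simp add: flow_def) (simp add: restrict_net_def surplus_def incidence_def)
  then show ?thesis using flow_if_subnet_flow[OF assms(1) subset_refl assms(2)] by blast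
qed

context
  fixes N :: "('v, 'e) net" and A X :: "'v set" and s :: "'e \<Rightarrow> int"
  assumes wf: "wf_net N" and A: "A \<subseteq> nodes N" and s: "signing (arcs N) s" and X: "X \<subseteq> A"
begin

private lemma finite_sets: "finite (arcs N)" "finite X"
  using wf A X by (auto simp: wf_net_def intro: finite_subset)

lemma degree_restrict_net: "degree (restrict_net N A s) X = degree N X"
proof -
  let ?O = "arcs N - inner_arcs N A" and ?T = "new_tips N A s"
  have tips: "card (?T (-1) v) + card (?T 1 v) = card (cut_arcs N {v} - inner_arcs N A)"
    if "v \<in> X" for v
  proof -
    have "?T (-1) v \<union> ?T 1 v = cut_arcs N {v} - inner_arcs N A"
      using that X s
      by (auto simp: new_tips_def cut_arcs_def inner_arcs_def incidence_def signing_def)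
    moreover have "card (?T (-1) v \<union> ?T 1 v) = card (?T (-1) v) + card (?T 1 v)"
      using finite_sets(1) by (intro card_Un_disjoint) (auto simp: new_tips_def)
    ultimately show ?thesis by simp
  qed
  have "(\<Union>v\<in>X. cut_arcs N {v} - inner_arcs N A) = cut_arcs N X - inner_arcs N A"
    using X by (auto simp: cut_arcs_def inner_arcs_def)
  moreover have "card (\<Union>v\<in>X. cut_arcs N {v} - inner_arcs N A) =
      (\<Sum>v\<in>X. card (cut_arcs N {v} - inner_arcs N A))"
    using finite_sets X
    by (intro card_UN_disjoint) (auto simp: finite_cut_arcs cut_arcs_def inner_arcs_def)
  ultimately have "(\<Sum>v\<in>X. card (?T (-1) v) + card (?T 1 v)) = card (cut_arcs N X - inner_arcs N A)"
    using tips by simp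
  moreover have "degree (subnet N A (inner_arcs N A) s) X + card (cut_arcs N X - inner_arcs N A) =
      degree N X"
    by (rule degree_subnet[OF finite_sets(1) inner_arcs_subset])
  ultimately show ?thesis
    by (simp add: degree_def restrict_net_def tips_def cut_arcs_def sum.distrib)
qed

lemma border_restrict_net: "border (restrict_net N A s) X = border N X"
proof -
  let ?O = "arcs N - inner_arcs N A"
  have "(\<Sum>e\<in>?O. s e * incidence N e {v}) =
      int (card (new_tips N A s 1 v)) - int (card (new_tips N A s (-1) v))"
    for v
  proof -
    have "(\<Sum>e\<in>?O. s e * incidence N e {v}) =
        (\<Sum>e\<in>?O. of_bool (s e * incidence N e {v} = 1) - of_bool (s e * incidence N e {v} = -1))"
      using s by (intro sum.cong) (auto simp: signing_def incidence_def)
    then show ?thesis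
      using finite_sets(1) by (simp add: sum_subtractf new_tips_def Int_def conj_commute)
  qed
  then show ?thesis by (simp add: border_def restrict_net_def subnet_def algebra_simps)
qed

end

text \<open>The weight 2 pays for restricting to a vertex set, where every cut arc becomes a tip edge.\<close>

definition net_size :: "('v, 'e) net \<Rightarrow> nat" where
  "net_size N = 2 * card (arcs N) + card (nodes N) + degree N (nodes N)"

lemma net_size_restrict_net:
  assumes wf: "wf_net N" and A: "A \<subset> nodes N" and s: "signing (arcs N) s"
  shows "net_size (restrict_net N A s) < net_size N"
proof -
  have fin: "finite (nodes N)" "finite (arcs N)" using wf by (auto simp: wf_net_def)
  have "card (cut_arcs N A) + card (inner_arcs N A) = card (cut_arcs N A \<union> inner_arcs N A)"
    using fin(2) by (intro card_Un_disjoint[symmetric]) (auto simp: cut_arcs_def inner_arcs_def)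
  also have "\<dots> \<le> card (arcs N)"
    using fin(2) by (intro card_mono) (auto simp: cut_arcs_def inner_arcs_def)
  finally have "card (cut_arcs N A) + card (inner_arcs N A) \<le> card (arcs N)" .
  moreover have "(\<Sum>v\<in>A. tips N v) \<le> (\<Sum>v\<in>nodes N. tips N v)"
    using A fin(1) by (intro sum_mono2) auto
  moreover have "card A < card (nodes N)" using A fin(1) by (intro psubset_card_mono)
  moreover have "degree (restrict_net N A s) A = card (cut_arcs N A) + (\<Sum>v\<in>A. tips N v)"
    using degree_restrict_net[OF wf psubset_imp_subset[OF A] s subset_refl]
    by (simp add: degree_def)
  ultimately show ?thesis by (simp add: net_size_def degree_nodes[OF wf])
qed

lemma net_size_quotient_net:
  assumes wf: "wf_net N" and r: "\<not> inj_on r (nodes N)"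
  shows "net_size (quotient_net r N) < net_size N"
proof -
  have "card (r ` nodes N) \<noteq> card (nodes N)"
    using r eq_card_imp_inj_on[OF wf_netD(1)[OF wf]] by blast
  moreover have "card (r ` nodes N) \<le> card (nodes N)" by (rule card_image_le[OF wf_netD(1)[OF wf]])
  ultimately show ?thesis
    by (simp add: net_size_def degree_quotient_net[OF wf] preimage_nodes_image)
qed

lemma admissible_restrict_net:
  assumes wf: "wf_net N" and ample: "ample_net N" and A: "A \<subset> nodes N" and s: "flow_outside N A s"
    and anchored: "anchored N A"
  shows "admissible (restrict_net N A s)"
proof -
  have sign: "signing (arcs N) s" using s by (simp add: flow_outside_def)
  note degree = degree_restrict_net[OF wf psubset_imp_subset[OF A] sign]
  note border = border_restrict_net[OF wf psubset_imp_subset[OF A] sign]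
  have "ample_net (restrict_net N A s)"
    unfolding ample_net_def
  proof (intro allI impI, elim conjE)
    fix X assume X: "X \<noteq> {}" "X \<subset> nodes (restrict_net N A s)"
    then have "X \<subset> nodes N" "X \<subseteq> A" using A by auto
    then show "ample (degree (restrict_net N A s) X) (border (restrict_net N A s) X)"
      using ample_netD[OF ample X(1)] by (simp add: degree border)
  qed
  moreover have "anchored (restrict_net N A s) A"
    using anchored anchored_cong[OF degree] by simp
  ultimately show ?thesis
    using wf_restrict_net[OF wf psubset_imp_subset[OF A] s] by (simp add: admissible_def)
qed

lemma obtain_two_signs:
  obtains s t :: int where "s = 1 \<or> s = -1" "t = 1 \<or> t = -1" "3 dvd s + t + c"
proof -
  have "3 dvd 1 + 1 + c \<or> 3 dvd 1 + (-1) + c \<or> 3 dvd (-1) + (-1) + c" by presburger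
  then show ?thesis using that[of 1 1] that[of 1 "-1"] that[of "-1" "-1"] by auto
qed

lemma flow_two_nodes:
  assumes wf: "wf_net N" and uv: "nodes N = {u, v}" "u \<noteq> v"
    and d: "d \<in> cut_arcs N {u}" and e: "e \<in> cut_arcs N {u}" and "d \<noteq> e"
  shows "\<exists>f. flow N f"
proof -
  let ?i = "\<lambda>e. incidence N e {u}"
  define c where "c = (\<Sum>e\<in>arcs N - {d} - {e}. ?i e) - demand N u"
  obtain s t :: int where st: "s = 1 \<or> s = -1" "t = 1 \<or> t = -1" "3 dvd s + t + c"
    by (rule obtain_two_signs)
  define f where "f = (\<lambda>_. 1)(d := s * ?i d, e := t * ?i e)"
  have incident: "?i d = 1 \<or> ?i d = -1" "?i e = 1 \<or> ?i e = -1" "d \<in> arcs N" "e \<in> arcs N - {d}"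
    using d e \<open>d \<noteq> e\<close> by (auto simp: cut_arcs_def incidence_def)
  have fin: "finite (arcs N)" by (rule wf_netD(2)[OF wf])
  have "(\<Sum>e\<in>arcs N. f e * ?i e) = f d * ?i d + (f e * ?i e + (\<Sum>e\<in>arcs N - {d} - {e}. f e * ?i e))"
    using sum.remove[OF fin incident(3), of "\<lambda>e. f e * ?i e"]
      sum.remove[OF _ incident(4), of "\<lambda>e. f e * ?i e"] fin
    by simp
  also have "(\<Sum>e\<in>arcs N - {d} - {e}. f e * ?i e) = (\<Sum>e\<in>arcs N - {d} - {e}. ?i e)"
    by (intro sum.cong) (auto simp: f_def)
  finally have "(\<Sum>e\<in>arcs N. f e * ?i e) = f d * ?i d + (f e * ?i e + (c + demand N u))"
    by (simp add: c_def)
  moreover have "f d * ?i d = s" "f e * ?i e = t" using incident(1,2) \<open>d \<noteq> e\<close> by (auto simp: f_def)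
  ultimately have "surplus N f {u} = s + t + c" by (simp add: surplus_def)
  then have balanced_u: "3 dvd surplus N f {u}" using st by simp
  have "{u, v} - {u} = {v}" using uv by auto
  then have "surplus N f {u, v} = surplus N f {v} + surplus N f {u}"
    using surplus_subset_diff[of "{u, v}" "{u}" N f] by simp
  then have "3 dvd surplus N f {v}"
    using balanced_u surplus_nodes_dvd[OF wf, of f] uv(1) by (simp add: dvd_add_left_iff)
  moreover have "f d' = 1 \<or> f d' = -1" for d' using incident(1,2) st(1,2) by (auto simp: f_def)
  ultimately have "flow N f" using balanced_u uv(1) by (simp add: flow_def signing_def)
  then show ?thesis by blast
qed

subsection \<open>Minimal counterexamples\<close>

locale minimal_net =
  fixes N :: "('v, 'e) net"
  assumes admissible: "admissible N"
    and no_flow: "\<not> flow N f"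
    and smaller_flow: "\<And>M :: ('v, 'e) net. admissible M \<Longrightarrow> net_size M < net_size N \<Longrightarrow> \<exists>f. flow M f"
begin

lemma wf: "wf_net N" and ample: "ample_net N" and anchored: "anchored N (nodes N)"
  using admissible by (auto simp: admissible_def)

lemma finite_nodes [simp]: "finite (nodes N)" and finite_arcs [simp]: "finite (arcs N)"
  using wf by (auto simp: wf_net_def)

lemma finite_node_set: "X \<subseteq> nodes N \<Longrightarrow> finite X"
  using finite_nodes finite_subset by blast

lemma nodes_nonempty: "nodes N \<noteq> {}"
  using anchored by (auto simp: anchored_def anchor_def twin_anchors_def)

lemma nodes_not_singleton: "nodes N \<noteq> {v}"
  using flow_single_node[OF wf] no_flow by auto

lemma singleton_proper: "v \<in> nodes N \<Longrightarrow> {v} \<subset> nodes N"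
  using nodes_not_singleton by auto

lemma obtain_other_node:
  obtains w where "w \<in> nodes N" "w \<noteq> v"
  using nodes_not_singleton[of v] nodes_nonempty by blast

lemma ample_proper: "X \<noteq> {} \<Longrightarrow> X \<subset> nodes N \<Longrightarrow> ample (degree N X) (border N X)"
  using ample_netD[OF ample] .

lemma degree_ge_4: "X \<noteq> {} \<Longrightarrow> X \<subset> nodes N \<Longrightarrow> 4 \<le> degree N X"
  using degree_ge_4_if_ample_net[OF ample] .

lemma ample_single: "v \<in> nodes N \<Longrightarrow> ample (degree N {v}) (border N {v})"
  using ample_proper[of "{v}"] singleton_proper by simp

lemma obtain_flow_outside:
  assumes A: "A \<subseteq> nodes N" "2 \<le> card A"
  obtains s where "flow_outside N A s"
proof -
  obtain a b where ab: "a \<in> A" "b \<in> A" "a \<noteq> b"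
    using A(2) by (auto simp: numeral_2_eq_2 card_le_Suc_iff)
  define r where "r v = (if v \<in> A then a else v)" for v
  have "\<not> inj_on r (nodes N)" using ab A(1) by (auto simp: inj_on_def r_def)
  then obtain f where f: "flow (quotient_net r N) f"
    using smaller_flow admissible_quotient_net[OF admissible] net_size_quotient_net[OF wf] by blast
  have "3 dvd surplus N f {v}" if v: "v \<in> nodes N - A" for v
  proof -
    have "r v = v" using v by (simp add: r_def)
    then have rv: "v \<in> r ` nodes N" using v by (metis DiffD1 imageI)
    then have "3 dvd surplus (quotient_net r N) f {v}"
      using f unfolding flow_def nodes_quotient_net by blast
    moreover have "preimage_nodes r N {v} = {v}"
      using v ab(1) by (auto simp: preimage_nodes_def r_def split: if_splits)
    ultimately show ?thesis using surplus_quotient_net[OF wf, of "{v}" r f] rv by simp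
  qed
  then have "flow_outside N A f" using f by (simp add: flow_outside_def flow_def)
  then show ?thesis using that by blast
qed

lemma not_anchored:
  assumes "A \<subset> nodes N" "2 \<le> card A"
  shows "\<not> anchored N A"
proof
  assume "anchored N A"
  obtain s where s: "flow_outside N A s" using obtain_flow_outside assms by blast
  then have "net_size (restrict_net N A s) < net_size N"
    using net_size_restrict_net[OF wf assms(1)] by (simp add: flow_outside_def)
  then show False
    using smaller_flow admissible_restrict_net[OF wf ample assms(1) s \<open>anchored N A\<close>] no_flow
      flow_if_restrict_net_flow[OF wf s] by blast
qed

lemma no_parallel_arcs:
  assumes "u \<in> nodes N" "v \<in> nodes N" "u \<noteq> v"
    and d: "d \<in> cut_arcs N {u} \<inter> cut_arcs N {v}" and e: "e \<in> cut_arcs N {u} \<inter> cut_arcs N {v}"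
  shows "d = e"
proof (rule ccontr)
  assume "d \<noteq> e"
  have uv: "{u, v} \<subseteq> nodes N" "2 \<le> card {u, v}" using assms(1-3) by auto
  then obtain s where s: "flow_outside N {u, v} s" by (rule obtain_flow_outside)
  let ?R = "restrict_net N {u, v} s"
  have "d \<in> cut_arcs ?R {u}" "e \<in> cut_arcs ?R {u}"
    using d e \<open>u \<noteq> v\<close> by (auto simp: cut_arcs_def inner_arcs_def)
  then obtain g where "flow ?R g"
    using flow_two_nodes[OF wf_restrict_net[OF wf uv(1) s] _ \<open>u \<noteq> v\<close>] \<open>d \<noteq> e\<close> by auto
  then show False using flow_if_restrict_net_flow[OF wf s] no_flow by blast
qed

end

subsection \<open>Symmetries\<close>

definition mirror :: "('v, 'e) net \<Rightarrow> ('v, 'e) net" where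
  "mirror N = N\<lparr>tip_in := tip_out N, tip_out := tip_in N, demand := (\<lambda>v. - demand N v)\<rparr>"

definition reverse_arcs :: "('v, 'e) net \<Rightarrow> 'e set \<Rightarrow> ('v, 'e) net" where
  "reverse_arcs N R = N\<lparr>tail := (\<lambda>e. if e \<in> R then head N e else tail N e),
     head := (\<lambda>e. if e \<in> R then tail N e else head N e)\<rparr>"

lemma degree_mirror: "degree (mirror N) X = degree N X"
  by (simp add: degree_def cut_arcs_def tips_def mirror_def add.commute)

lemma border_mirror: "border (mirror N) X = - border N X"
  by (simp add: border_def mirror_def sum_negf[symmetric] algebra_simps)

lemma surplus_mirror: "surplus (mirror N) f X = - surplus N (\<lambda>e. - f e) X"
  by (simp add: surplus_def mirror_def incidence_def sum_negf)

lemma degree_reverse_arcs: "degree (reverse_arcs N R) X = degree N X"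
proof -
  have "cut_arcs (reverse_arcs N R) X = cut_arcs N X"
    by (auto simp: cut_arcs_def reverse_arcs_def)
  then show ?thesis by (simp add: degree_def) (simp add: reverse_arcs_def tips_def)
qed

lemma border_reverse_arcs: "border (reverse_arcs N R) X = border N X"
  by (simp add: border_def reverse_arcs_def)

lemma surplus_reverse_arcs:
  "surplus (reverse_arcs N R) f X = surplus N (\<lambda>e. if e \<in> R then - f e else f e) X"
  unfolding surplus_def
  by (intro arg_cong2[where f = "(-)"] sum.cong) (auto simp: incidence_def reverse_arcs_def)

lemma minimal_net_transfer:
  fixes M N :: "('v, 'e) net"
  assumes "minimal_net N" and "wf_net M" "nodes M = nodes N" "card (arcs M) = card (arcs N)"
    and degree: "\<And>X. degree M X = degree N X"
    and border: "\<And>X. border M X = border N X \<or> border M X = - border N X"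
    and flow: "\<And>f. flow M f \<Longrightarrow> \<exists>g. flow N g"
  shows "minimal_net M"
proof -
  interpret minimal_net N by fact
  show ?thesis
  proof
    show "admissible M" by (rule admissible_transfer[OF admissible]) fact+
    show "\<not> flow M f" for f using flow no_flow by blast
    show "\<exists>f. flow M' f" if "admissible M'" "net_size M' < net_size M" for M' :: "('v, 'e) net"
      using that smaller_flow assms(3,4) degree by (simp add: net_size_def)
  qed
qed

context minimal_net
begin

lemma minimal_net_mirror: "minimal_net (mirror N)"
proof (rule minimal_net_transfer[OF minimal_net_axioms])
  show "wf_net (mirror N)" using wf by (simp add: wf_net_def mirror_def sum_negf)
  fix f assume "flow (mirror N) f"
  then have "flow N (\<lambda>e. - f e)"
    by (auto simp: flow_def signing_def surplus_mirror) (auto simp: mirror_def)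
  then show "\<exists>g. flow N g" by blast
qed (simp_all add: degree_mirror border_mirror, simp_all add: mirror_def)

lemma minimal_net_reverse_arcs: "minimal_net (reverse_arcs N R)"
proof (rule minimal_net_transfer[OF minimal_net_axioms])
  show "wf_net (reverse_arcs N R)" using wf by (auto simp: wf_net_def reverse_arcs_def)
  fix f assume "flow (reverse_arcs N R) f"
  then have "flow N (\<lambda>e. if e \<in> R then - f e else f e)"
    by (auto simp: flow_def signing_def surplus_reverse_arcs) (auto simp: reverse_arcs_def)
  then show "\<exists>g. flow N g" by blast
qed (simp_all add: degree_reverse_arcs border_reverse_arcs, simp_all add: reverse_arcs_def)

subsection \<open>Small cuts of a minimal counterexample\<close>

lemma degree_ge_6:
  assumes "A \<subset> nodes N" "2 \<le> card A"
  shows "6 \<le> degree N A"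
proof (rule ccontr)
  assume "\<not> 6 \<le> degree N A"
  moreover have "A \<noteq> {}" using assms(2) by auto
  moreover have "4 \<le> degree N X" if "X \<noteq> {}" "X \<subset> A" for X
    using that assms(1) by (intro degree_ge_4) auto
  ultimately have "anchored N A" by (intro anchored_if_degree_le_5) auto
  then show False using not_anchored assms by blast
qed

lemma eq_singleton_or_degree_ge_6:
  assumes "X \<subset> nodes N" "x \<in> X"
  shows "X = {x} \<or> 2 \<le> card X \<and> 6 \<le> degree N X"
  using eq_singleton_or_card_ge_2[OF finite_node_set assms(2)] degree_ge_6[OF assms(1)] assms(1)
  by auto

context
  fixes A
  assumes A: "A \<subset> nodes N" "2 \<le> card A"
begin

private lemma degree_subset_ge_6: "X \<subset> A \<Longrightarrow> 2 \<le> card X \<Longrightarrow> 6 \<le> degree N X"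
  using degree_ge_6 A(1) by blast

private lemma finite_A: "finite A"
  using A(1) finite_node_set by blast

lemma degree_single_le:
  assumes "v \<in> A" "degree N A \<le> 7"
  shows "degree N {v} + 2 \<le> degree N A"
proof (rule ccontr)
  assume "\<not> ?thesis"
  then have "anchor N A v"
    using assms by (intro anchor_if_degree_le_7 finite_A degree_subset_ge_6) auto
  then show False using not_anchored[OF A] by (blast intro: anchored_if_anchor)
qed

lemma degree_7_unique_single:
  assumes "degree N A = 7" "v \<in> A" "5 \<le> degree N {v}" "w \<in> A" "5 \<le> degree N {w}"
  shows "v = w"
proof (rule ccontr)
  assume "v \<noteq> w"
  then have "twin_anchors N A v w"
    using assms by (intro twin_anchors_if_degree_7 finite_A degree_subset_ge_6)
  then show False using not_anchored[OF A] by (blast intro: anchored_if_twin_anchors)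
qed

end

lemma border_dvd_if_degree_4: "v \<in> nodes N \<Longrightarrow> degree N {v} = 4 \<Longrightarrow> 3 dvd border N {v}"
  using ample_single by (auto simp: ample_def)

lemma degree_single_ge_4: "v \<in> nodes N \<Longrightarrow> 4 \<le> degree N {v}"
  using ample_single ample_ge_4 by blast

lemma border_dvd_if_degree_6:
  assumes A: "A \<subset> nodes N" "2 \<le> card A" and deg: "degree N A = 6"
  shows "3 dvd border N A"
proof -
  have "degree N {v} = 4" if "v \<in> A" for v
    using degree_single_le[OF A that] degree_single_ge_4[of v] that A(1) deg by auto
  then show ?thesis
    unfolding border_eq_sum[of N A] using A(1) by (intro dvd_sum border_dvd_if_degree_4) auto
qed

lemma border_not_dvd_if_degree_7:
  assumes A: "A \<subset> nodes N" "2 \<le> card A" and deg: "degree N A = 7"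
  shows "\<not> 3 dvd border N A"
proof -
  have fin: "finite A" using A(1) finite_node_set by blast
  have range: "degree N {v} = 4 \<or> degree N {v} = 5" if "v \<in> A" for v
    using degree_single_le[OF A that] degree_single_ge_4[of v] that A(1) deg by auto
  have "\<exists>u\<in>A. degree N {u} \<noteq> 4"
  proof (rule ccontr)
    assume "\<not> ?thesis"
    then have "even (\<Sum>v\<in>A. degree N {v})" by (intro dvd_sum) auto
    then show False using even_degree_iff[OF finite_arcs fin] deg by simp
  qed
  then obtain u where u: "u \<in> A" "degree N {u} = 5" using range by blast
  have "degree N {v} = 4" if "v \<in> A - {u}" for v
    using range[of v] degree_7_unique_single[OF A deg, of v u] that u by auto
  then have "3 dvd (\<Sum>v\<in>A - {u}. border N {v})"
    using A(1) by (intro dvd_sum border_dvd_if_degree_4) auto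
  moreover have "border N A = border N {u} + (\<Sum>v\<in>A - {u}. border N {v})"
    unfolding border_eq_sum[of N A] using fin u by (intro sum.remove)
  moreover have "\<not> 3 dvd border N {u}" using ample_single[of u] u A(1) by (auto simp: ample_def)
  ultimately show ?thesis by (simp add: dvd_add_left_iff)
qed

lemma ample_degree_minus_2:
  assumes A: "A \<subset> nodes N" "2 \<le> card A" and deg: "degree N A = d + 2"
  shows "ample d (border N A)"
  using degree_ge_6[OF A] border_dvd_if_degree_6[OF A] border_not_dvd_if_degree_7[OF A] deg
  by (auto simp: ample_def)

lemma degree_nodes_less_if_anchor:
  assumes x: "anchor N (nodes N) x" "x \<in> A" and A: "A \<subset> nodes N" "2 \<le> card A"
  shows "degree N (nodes N) < degree N A"
proof (rule ccontr)
  assume le: "\<not> ?thesis"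
  have "anchor N A x"
  proof (rule anchorI[OF x(2)])
    fix X assume "X \<subset> A" "x \<in> X"
    then have "degree N (nodes N) \<le> degree N X + 1" using anchorD(2)[OF x(1), of X] A(1) by auto
    then show "degree N A \<le> degree N X + 1" using le by simp
  qed
  then show False using not_anchored[OF A] by (blast intro: anchored_if_anchor)
qed

lemma singleton_if_min_degree:
  assumes A: "A \<noteq> {}" "A \<subset> nodes N" and min: "\<And>X. X \<noteq> {} \<Longrightarrow> X \<subset> nodes N \<Longrightarrow> degree N A \<le> degree N X"
  obtains a where "A = {a}"
proof -
  obtain a where a: "a \<in> A" using A(1) by blast
  have "anchor N A a"
  proof (rule anchorI[OF a])
    fix X assume X: "X \<subset> A" "a \<in> X"
    then have "degree N A \<le> degree N X" using A(2) by (intro min) auto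
    then show "degree N A \<le> degree N X + 1" by simp
  qed
  then have "\<not> 2 \<le> card A" using not_anchored[OF A(2)] by (blast intro: anchored_if_anchor)
  then have "A = {a}" using eq_singleton_or_card_ge_2[OF finite_node_set a] A(2) by auto
  then show ?thesis by (rule that)
qed

text \<open>Without tip edges a set and its complement have the same degree, so both sides of a smallest
  cut are singletons.\<close>

lemma degree_nodes_pos: "0 < degree N (nodes N)"
proof (rule ccontr)
  assume "\<not> ?thesis"
  then have "tips N v = 0" if "v \<in> nodes N" for v using that by (simp add: degree_nodes[OF wf])
  then have deg: "degree N X = card (cut_arcs N X)" if "X \<subseteq> nodes N" for X
    using that by (auto simp: degree_def intro!: sum.neutral)
  let ?P = "\<lambda>X. X \<noteq> {} \<and> X \<subset> nodes N"
  obtain u where "u \<in> nodes N" using nodes_nonempty by blast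
  then have "?P {u}" using singleton_proper by blast
  then have "\<exists>A. ?P A \<and> (\<forall>X. ?P X \<longrightarrow> degree N A \<le> degree N X)" by (rule ex_has_least_nat)
  then obtain A where "?P A \<and> (\<forall>X. ?P X \<longrightarrow> degree N A \<le> degree N X)" ..
  then have A: "?P A" and min: "\<forall>X. ?P X \<longrightarrow> degree N A \<le> degree N X" by simp_all
  have complement: "?P (nodes N - A)" "degree N (nodes N - A) = degree N A"
    using A deg cut_arcs_complement[OF wf] by auto
  obtain a where a: "A = {a}" using singleton_if_min_degree[of A] A min by blast
  obtain b where b: "nodes N - A = {b}"
    using singleton_if_min_degree[of "nodes N - A"] complement min by auto
  have ab: "nodes N = {a, b}" "a \<noteq> b" using a b A by auto
  have "4 \<le> card (cut_arcs N {a})" using degree_ge_4[of A] A deg[of A] a by auto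
  then have "\<not> card (cut_arcs N {a}) \<le> Suc 0" by simp
  then obtain d e where "d \<in> cut_arcs N {a}" "e \<in> cut_arcs N {a}" "d \<noteq> e"
    using card_le_Suc0_iff_eq[OF finite_cut_arcs[OF finite_arcs]] by blast
  then show False using flow_two_nodes[OF wf ab] no_flow by blast
qed

end

subsection \<open>Nodes of degree four\<close>

text \<open>For \<open>e \<in> L\<close> the arcs \<open>e\<close> and \<open>m e\<close>, which have a common tail, are replaced by one arc that
  joins their heads.\<close>

definition reroute :: "('v, 'e) net \<Rightarrow> 'e set \<Rightarrow> ('e \<Rightarrow> 'e) \<Rightarrow> ('v, 'e) net" where
  "reroute N L m = N\<lparr>arcs := arcs N - m ` L,
     tail := (\<lambda>e. if e \<in> L then head N (m e) else tail N e)\<rparr>"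

lemma reroute_simps [simp]:
  "nodes (reroute N L m) = nodes N" "arcs (reroute N L m) = arcs N - m ` L"
  "head (reroute N L m) = head N" "tips (reroute N L m) = tips N"
  by (simp_all add: reroute_def tips_def fun_eq_iff)

lemma border_reroute: "border (reroute N L m) X = border N X"
  by (simp add: border_def reroute_def)

context
  fixes N :: "('v, 'e) net" and L :: "'e set" and m :: "'e \<Rightarrow> 'e"
  assumes wf: "wf_net N" and L: "L \<subseteq> arcs N" "m ` L \<subseteq> arcs N" "L \<inter> m ` L = {}" "inj_on m L"
    and tails: "\<And>e. e \<in> L \<Longrightarrow> tail N (m e) = tail N e"
begin

lemma wf_reroute: "wf_net (reroute N L m)"
  using wf L(2) by (auto simp: wf_net_def reroute_def)

lemma degree_reroute:
  "degree (reroute N L m) X + 2 * card {e \<in> L. e \<in> cut_arcs N X \<and> m e \<in> cut_arcs N X} = degree N X"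
proof -
  let ?C = "cut_arcs N X" and ?M = "reroute N L m"
  define B where "B = {e \<in> L. m e \<in> ?C}"
  have fin: "finite ?C" "finite L" "finite B" "finite (m ` L)"
    using wf L by (auto simp: finite_cut_arcs wf_net_def B_def intro: finite_subset)
  have "cut_arcs ?M X = (?C - L - m ` L) \<union> sym_diff (?C \<inter> L) B"
    using L tails by (auto simp: cut_arcs_def reroute_def B_def)
  then have "card (cut_arcs ?M X) = card (?C - L - m ` L) + card (sym_diff (?C \<inter> L) B)"
    using fin by (simp only:) (intro card_Un_disjoint, auto simp: B_def)
  moreover have "card (sym_diff (?C \<inter> L) B) + 2 * card (?C \<inter> L \<inter> B) = card (?C \<inter> L) + card B"
    using fin by (intro card_sym_diff) auto
  moreover have "?C \<inter> L \<inter> B = {e \<in> L. e \<in> ?C \<and> m e \<in> ?C}" by (auto simp: B_def)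
  moreover have "card B = card (?C \<inter> m ` L)"
  proof -
    have "m ` B = ?C \<inter> m ` L" by (auto simp: B_def)
    then show ?thesis using card_image[OF inj_on_subset[OF L(4)], of B] by (auto simp: B_def)
  qed
  moreover have "card ?C = card (?C \<inter> L) + card (?C - L)" by (rule card_Int_Diff[OF fin(1)])
  moreover have "card (?C - L) = card ((?C - L) \<inter> m ` L) + card (?C - L - m ` L)"
    using fin by (intro card_Int_Diff) simp
  moreover have "(?C - L) \<inter> m ` L = ?C \<inter> m ` L" using L(3) by auto
  ultimately show ?thesis by (simp add: degree_def)
qed

lemma surplus_reroute:
  "surplus (reroute N L m) g X = surplus N (\<lambda>e. if e \<in> m ` L then - g (inv_into L m e) else g e) X"
proof -
  let ?f = "\<lambda>e. if e \<in> m ` L then - g (inv_into L m e) else g e"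
  let ?M = "reroute N L m" and ?A = "arcs N - m ` L"
  have fin: "finite ?A" "finite (arcs N)" using wf by (auto simp: wf_net_def)
  have L_kept: "L \<subseteq> ?A" using L(1,3) by auto
  have "(\<Sum>e\<in>arcs N. ?f e * incidence N e X) =
      (\<Sum>e\<in>?A. ?f e * incidence N e X) + (\<Sum>e\<in>m ` L. ?f e * incidence N e X)"
    using L(2) fin by (intro sum.subset_diff)
  also have "(\<Sum>e\<in>m ` L. ?f e * incidence N e X) = (\<Sum>e\<in>L. - g e * incidence N (m e) X)"
    using L(4) by (simp add: sum.reindex)
  also have "(\<Sum>e\<in>?A. ?f e * incidence N e X) =
      (\<Sum>e\<in>?A - L. g e * incidence N e X) + (\<Sum>e\<in>L. g e * incidence N e X)"
    using sum.subset_diff[OF L_kept fin(1)] by (simp cong: sum.cong_simp)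
  also have "\<dots> + (\<Sum>e\<in>L. - g e * incidence N (m e) X) = (\<Sum>e\<in>?A - L. g e * incidence N e X) +
      (\<Sum>e\<in>L. g e * incidence N e X + - g e * incidence N (m e) X)"
    by (simp only: sum.distrib add.assoc)
  also have "\<dots> = (\<Sum>e\<in>?A - L. g e * incidence ?M e X) + (\<Sum>e\<in>L. g e * incidence ?M e X)"
    using tails by (intro arg_cong2[where f = "(+)"] sum.cong)
      (auto simp: incidence_def reroute_def algebra_simps)
  also have "\<dots> = (\<Sum>e\<in>?A. g e * incidence ?M e X)"
    using L_kept fin(1) by (intro sum.subset_diff[symmetric])
  finally show ?thesis by (simp add: surplus_def) (simp add: reroute_def)
qed

lemma flow_if_reroute_flow:
  assumes "flow (reroute N L m) g"
  shows "\<exists>f. flow N f"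
proof -
  have "g (inv_into L m e) = 1 \<or> g (inv_into L m e) = -1" if "e \<in> m ` L" for e
  proof -
    have "inv_into L m e \<in> arcs N - m ` L" using inv_into_into[OF that] L(1,3) by auto
    then show ?thesis using assms by (simp add: flow_def signing_def)
  qed
  then have "flow N (\<lambda>e. if e \<in> m ` L then - g (inv_into L m e) else g e)"
    using assms by (auto simp: flow_def signing_def surplus_reroute)
  then show ?thesis by blast
qed

end

locale minimal_net_source = minimal_net N for N :: "('v, 'e) net" +
  fixes v :: 'v
  assumes source: "v \<in> nodes N" "\<And>e. e \<in> arcs N \<Longrightarrow> head N e = v \<Longrightarrow> tail N e = v"
begin

abbreviation star where "star \<equiv> cut_arcs N {v}"
abbreviation rest where "rest \<equiv> nodes N - {v}"

lemma finite_star [simp]: "finite star"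
  by (simp add: finite_cut_arcs)

lemma in_star_iff: "e \<in> star \<longleftrightarrow> e \<in> arcs N \<and> tail N e = v \<and> head N e \<noteq> v"
  using source(2) by (auto simp: cut_arcs_def)

lemma head_star: "e \<in> star \<Longrightarrow> head N e \<in> rest"
  using wf_netD(4)[OF wf] by (auto simp: in_star_iff)

lemma inj_on_head_star: "inj_on (head N) star"
proof (rule inj_onI)
  fix d e assume de: "d \<in> star" "e \<in> star" "head N d = head N e"
  have "e' \<in> star \<inter> cut_arcs N {head N e}" if "e' \<in> {d, e}" for e'
    using that de unfolding Int_iff in_star_iff by (auto simp: cut_arcs_def)
  then show "d = e"
    using no_parallel_arcs[OF source(1), of "head N e" d e] head_star[OF de(2)] by auto
qed

lemma degree_source: "degree N {v} = card star + tips N v"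
  by (simp add: degree_def)

lemma in_cut_arcs_iff_head:
  assumes "v \<notin> X" "e \<in> star"
  shows "e \<in> cut_arcs N X \<longleftrightarrow> head N e \<in> X"
  using assms(1) assms(2)[unfolded in_star_iff] by (simp add: cut_arcs_def)

lemma tips_le_2_if_degree_4:
  assumes "degree N {v} = 4"
  shows "tips N v \<le> 2"
proof (rule ccontr)
  assume "\<not> ?thesis"
  then have less: "degree N (rest) + 2 \<le> degree N (nodes N)"
    using degree_remove_node[OF wf source(1)] assms by simp
  have proper: "rest \<noteq> {}" "rest \<subset> nodes N"
    using nodes_not_singleton[of v] source(1) by auto
  from anchored show False
  proof (cases rule: anchoredE)
    case (anchor x)
    note x = anchorD[OF this]
    have "x = v" using x(2)[of "rest"] x(1) less by fastforce
    then have "degree N (nodes N) \<le> 5" using x(2)[of "{v}"] assms source(1) by simp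
    then show False using degree_ge_4[OF proper] less by simp
  next
    case (twin_anchors x y)
    note xy = twin_anchorsD[OF this]
    have "x \<noteq> v" "y \<noteq> v" using xy(5)[of "{v}"] assms source(1) by auto
    then show False using xy(6)[of "rest"] xy(1-3) less by simp
  qed
qed

end

text \<open>Splitting off a node \<open>v\<close> of degree 4: its tip edges into and out of \<open>v\<close> are matched with \<open>P\<close> and
  \<open>Q\<close>, and the remaining arcs \<open>L \<union> m ` L\<close> with each other.\<close>

locale splitting = minimal_net_source N v for N :: "('v, 'e) net" and v +
  fixes P Q L m
  assumes degree_4: "degree N {v} = 4"
    and star_eq: "star = P \<union> Q \<union> (L \<union> m ` L)"
    and disjoint: "P \<inter> Q = {}" "(P \<union> Q) \<inter> (L \<union> m ` L) = {}" "L \<inter> m ` L = {}"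
    and inj_m: "inj_on m L"
    and card_P: "card P = tip_in N v" and card_Q: "card Q = tip_out N v"
begin

abbreviation lifted where "lifted \<equiv> reroute N L m"
abbreviation sign :: "'e \<Rightarrow> int" where "sign e \<equiv> if e \<in> P then 1 else -1"
abbreviation split_off where "split_off \<equiv> restrict_net lifted rest sign"

lemma finite_parts: "finite P" "finite Q" "finite L"
  using finite_star unfolding star_eq by auto

lemma card_L: "card L + tips N v = 2"
proof -
  have "card star = card (P \<union> Q) + card (L \<union> m ` L)"
    unfolding star_eq using disjoint finite_parts by (intro card_Un_disjoint) auto
  also have "\<dots> = (card P + card Q) + (card L + card (m ` L))"
    using disjoint finite_parts by (intro arg_cong2[where f = "(+)"] card_Un_disjoint) auto
  finally show ?thesis
    using degree_source degree_4 card_P card_Q by (simp add: card_image[OF inj_m] tips_def)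
qed

lemma rerouting:
  "L \<subseteq> arcs N" "m ` L \<subseteq> arcs N" "L \<inter> m ` L = {}" "inj_on m L" "\<And>e. e \<in> L \<Longrightarrow> tail N (m e) = tail N e"
proof -
  have "e \<in> arcs N \<and> tail N e = v" if "e \<in> L \<union> m ` L" for e
    using in_star_iff[of e] that unfolding star_eq by blast
  then show "L \<subseteq> arcs N" "m ` L \<subseteq> arcs N" "\<And>e. e \<in> L \<Longrightarrow> tail N (m e) = tail N e"
    by auto
qed (fact disjoint inj_m)+

lemmas wf_lifted = wf_reroute[OF wf rerouting]

lemma flow_outside_lifted: "flow_outside lifted rest sign"
proof -
  have "(\<Sum>e\<in>arcs lifted. sign e * incidence lifted e {v}) = (\<Sum>e\<in>P \<union> Q. sign e)"
  proof (rule sum.mono_neutral_cong_right)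
    show "P \<union> Q \<subseteq> arcs lifted" using star_eq disjoint by (auto simp: cut_arcs_def)
    show "\<forall>e\<in>arcs lifted - (P \<union> Q). sign e * incidence lifted e {v} = 0"
    proof
      fix e assume e: "e \<in> arcs lifted - (P \<union> Q)"
      show "sign e * incidence lifted e {v} = 0"
      proof (cases "e \<in> L")
        case True
        then have "e \<in> star" "m e \<in> star" using star_eq by auto
        then show ?thesis using True by (simp add: incidence_def reroute_def in_star_iff)
      next
        case False
        then have "e \<notin> star" "e \<in> arcs N" using e star_eq by auto
        then show ?thesis using False by (auto simp: incidence_def reroute_def cut_arcs_def)
      qed
    qed
    fix e assume e: "e \<in> P \<union> Q"
    then have "e \<in> star" "e \<notin> L" using star_eq disjoint by auto
    then show "sign e * incidence lifted e {v} = sign e"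
      by (simp add: incidence_def reroute_def in_star_iff)
  qed (simp add: wf)
  also have "\<dots> = (\<Sum>e\<in>P. sign e) + (\<Sum>e\<in>Q. sign e)"
    using finite_parts disjoint by (intro sum.union_disjoint) auto
  also have "(\<Sum>e\<in>Q. sign e) = (\<Sum>e\<in>Q. - 1)"
    using disjoint by (intro sum.cong) auto
  finally have "surplus lifted sign {v} = - border N {v}"
    using card_P card_Q by (simp add: surplus_def border_def) (simp add: reroute_def)
  then show ?thesis
    using border_dvd_if_degree_4[OF source(1) degree_4] source(1)
    by (auto simp: flow_outside_def signing_def)
qed

lemma signing_lifted: "signing (arcs lifted) sign"
  by (simp add: signing_def)

lemma degree_split_off:
  assumes "X \<subseteq> rest"
  shows "degree split_off X + 2 * card {e \<in> L. e \<in> cut_arcs N X \<and> m e \<in> cut_arcs N X} = degree N X"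
  using degree_restrict_net[OF wf_lifted _ signing_lifted assms] degree_reroute[OF wf rerouting]
  by simp

lemma border_split_off: "X \<subseteq> rest \<Longrightarrow> border split_off X = border N X"
  using border_restrict_net[OF wf_lifted _ signing_lifted, of rest X] by (simp add: border_reroute)

lemma degree_split_off_rest: "degree split_off rest = degree N (nodes N)"
proof -
  have "{e \<in> L. e \<in> cut_arcs N rest \<and> m e \<in> cut_arcs N rest} = L"
    unfolding cut_arcs_complement[OF wf] using star_eq by auto
  then have "degree split_off rest + 2 * card L = degree N rest"
    using degree_split_off[OF subset_refl] by simp
  then show ?thesis using degree_remove_node[OF wf source(1)] card_L degree_4 by simp
qed

lemma degree_split_off_cases:
  assumes X: "X \<subseteq> rest"
  obtains "degree split_off X = degree N X"
  | "degree split_off X = degree N (insert v X)"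
  | "degree split_off X + 2 = degree N X" "2 \<le> card X"
proof -
  let ?B = "{e \<in> L. e \<in> cut_arcs N X \<and> m e \<in> cut_arcs N X}"
  have fin: "finite X" "finite ?B" using X finite_node_set finite_parts by auto
  have "card ?B \<le> card L" using finite_parts by (intro card_mono) auto
  then consider (none) "card ?B = 0" | (one) "card ?B = 1" | (two) "card ?B = 2" "card L = 2"
    using card_L by linarith
  then show ?thesis
  proof cases
    case none
    then show ?thesis using degree_split_off[OF X] that(1) by simp
  next
    case one
    then obtain e where "?B = {e}" by (rule card_1_singletonE)
    then have "e \<in> ?B" by simp
    then have e: "e \<in> star" "m e \<in> star" "e \<noteq> m e" "e \<in> cut_arcs N X" "m e \<in> cut_arcs N X"
      using star_eq disjoint by auto
    then have "head N e \<in> X" "head N (m e) \<in> X" "head N e \<noteq> head N (m e)"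
      using in_cut_arcs_iff_head[of X] X inj_onD[OF inj_on_head_star, of e "m e"] by auto
    then have "2 \<le> card X" using card_mono[of X "{head N e, head N (m e)}"] fin(1) by auto
    then show ?thesis using degree_split_off[OF X] one that(3) by simp
  next
    case two
    then have "?B = L" using finite_parts by (intro card_subset_eq) auto
    moreover have "P = {}" "Q = {}"
      using two card_L card_P card_Q finite_parts by (auto simp: tips_def)
    ultimately have "star \<subseteq> cut_arcs N X" unfolding star_eq by blast
    then have "cut_arcs N X \<inter> star = star" by blast
    moreover have "card star = 4" using degree_source degree_4 card_L two by simp
    moreover have "v \<notin> X" using X by auto
    ultimately have "degree N (insert v X) + 8 = degree N X + 4"
      using degree_insert[OF finite_arcs fin(1), of v] degree_4 by simp
    then show ?thesis using degree_split_off[OF X] two that(2) by simp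
  qed
qed

lemma ample_split_off:
  assumes X: "X \<noteq> {}" "X \<subset> rest"
  shows "ample (degree split_off X) (border split_off X)"
proof -
  have sub: "X \<subseteq> rest" "X \<subset> nodes N" "insert v X \<subset> nodes N" using X(2) source(1) by auto
  have border: "border split_off X = border N X" by (rule border_split_off[OF sub(1)])
  show ?thesis
  proof (rule degree_split_off_cases[OF sub(1)])
    assume "degree split_off X = degree N X"
    then show ?thesis using ample_proper[OF X(1) sub(2)] border by simp
  next
    assume deg: "degree split_off X = degree N (insert v X)"
    have "v \<notin> X" "finite X" using sub finite_node_set by auto
    then have "border N (insert v X) = border N {v} + border N X" by (simp add: border_def)
    then show ?thesis
      using ample_proper[OF _ sub(3)] border_dvd_if_degree_4[OF source(1) degree_4] deg border
      by (simp add: ample_add_multiple)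
  next
    assume "degree split_off X + 2 = degree N X" "2 \<le> card X"
    then show ?thesis using ample_degree_minus_2[OF sub(2)] border by simp
  qed
qed

lemma anchor_split_off:
  assumes x: "anchor N (nodes N) x" "x \<noteq> v"
  shows "anchor split_off rest x"
proof (rule anchorI)
  show "x \<in> rest" using x by (simp add: anchor_def)
next
  fix X assume X: "X \<subset> rest" "x \<in> X"
  then have sub: "X \<subseteq> rest" "X \<subset> nodes N" "insert v X \<subseteq> nodes N" using source(1) by auto
  show "degree split_off rest \<le> degree split_off X + 1"
    unfolding degree_split_off_rest
  proof (rule degree_split_off_cases[OF sub(1)])
    assume "degree split_off X = degree N X"
    then show "degree N (nodes N) \<le> degree split_off X + 1"
      using anchorD(2)[OF x(1), of X] X(2) sub(2) by auto
  next
    assume "degree split_off X = degree N (insert v X)"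
    then show "degree N (nodes N) \<le> degree split_off X + 1"
      using anchorD(2)[OF x(1) sub(3)] X(2) by simp
  next
    assume "degree split_off X + 2 = degree N X" "2 \<le> card X"
    then show "degree N (nodes N) \<le> degree split_off X + 1"
      using degree_nodes_less_if_anchor[OF x(1) X(2) sub(2)] by simp
  qed
qed

lemma twin_anchors_split_off:
  assumes xy: "twin_anchors N (nodes N) x y"
  shows "twin_anchors split_off rest x y"
proof -
  note twin = twin_anchorsD[OF xy]
  have ge_5: "5 \<le> degree N {x}" "5 \<le> degree N {y}"
    using twin(5)[of "{x}"] twin(5)[of "{y}"] twin(2,3) by auto
  then have "x \<noteq> v" "y \<noteq> v" using degree_4 by auto
  moreover have "5 \<le> degree split_off X \<and> (x \<in> X \<and> y \<in> X \<longrightarrow> 6 \<le> degree split_off X)"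
    if X: "X \<subseteq> rest" "x \<in> X \<or> y \<in> X" for X
  proof -
    have sub: "X \<subset> nodes N" "insert v X \<subseteq> nodes N" using X(1) source(1) by auto
    have ge_7: "7 \<le> degree N X" if "2 \<le> card X"
      using degree_ge_6[OF sub(1) that] degree_single_le[OF sub(1) that, of x]
        degree_single_le[OF sub(1) that, of y] ge_5 X(2) by fastforce
    have ge_8: "8 \<le> degree N X" if "2 \<le> card X" "x \<in> X" "y \<in> X"
      using ge_7 degree_7_unique_single[OF sub(1) that(1) _ that(2) ge_5(1) that(3) ge_5(2)]
        twin(4) that(1)
      by fastforce
    show ?thesis
    proof (rule degree_split_off_cases[OF X(1)])
      assume "degree split_off X = degree N X"
      then show ?thesis using twin(5,6)[of X] sub(1) X(2) by auto
    next
      assume "degree split_off X = degree N (insert v X)"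
      then show ?thesis using twin(5,6)[OF sub(2)] X(2) by auto
    next
      assume "degree split_off X + 2 = degree N X" "2 \<le> card X"
      then show ?thesis using ge_7 ge_8 by auto
    qed
  qed
  ultimately show ?thesis
    unfolding twin_anchors_def degree_split_off_rest using twin(1-4) by blast
qed

lemma anchored_split_off: "anchored split_off rest"
proof -
  from anchored show ?thesis
  proof (cases rule: anchoredE)
    case (anchor x)
    show ?thesis
    proof (cases "x = v")
      case True
      have "rest \<noteq> {}" using nodes_not_singleton[of v] source(1) by auto
      moreover have "degree split_off rest \<le> 5"
        using anchorD(2)[OF anchor, of "{v}"] True source(1) degree_4 degree_split_off_rest by simp
      moreover have "4 \<le> degree split_off X" if "X \<noteq> {}" "X \<subset> rest" for X
        by (rule ample_ge_4[OF ample_split_off[OF that]])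
      ultimately show ?thesis by (rule anchored_if_degree_le_5)
    next
      case False
      show ?thesis by (rule anchored_if_anchor[OF anchor_split_off[OF anchor False]])
    qed
  next
    case (twin_anchors x y)
    show ?thesis by (rule anchored_if_twin_anchors[OF twin_anchors_split_off[OF twin_anchors]])
  qed
qed

lemma splitting_impossible: False
proof -
  have rest: "rest \<subset> nodes lifted" using source(1) by auto
  have "wf_net split_off"
    using wf_restrict_net[OF wf_lifted psubset_imp_subset[OF rest] flow_outside_lifted] .
  then have "admissible split_off"
    using ample_split_off anchored_split_off by (simp add: admissible_def ample_net_def)
  moreover have "net_size split_off < net_size N"
  proof -
    have "net_size split_off < net_size lifted"
      by (rule net_size_restrict_net[OF wf_lifted rest signing_lifted])
    moreover have "card (arcs lifted) \<le> card (arcs N)" by (intro card_mono) auto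
    moreover have "degree lifted (nodes N) \<le> degree N (nodes N)"
      using degree_reroute[OF wf rerouting, of "nodes N"] by simp
    ultimately show ?thesis by (simp add: net_size_def)
  qed
  ultimately obtain g where "flow split_off g" using smaller_flow by blast
  then obtain f where "flow lifted f"
    using flow_if_restrict_net_flow[OF wf_lifted flow_outside_lifted] by blast
  then show False using flow_if_reroute_flow[OF wf rerouting] no_flow by blast
qed

end

lemma obtain_pairing:
  assumes "finite S" "even (card S)"
  obtains L and m :: "'a \<Rightarrow> 'a" where "S = L \<union> m ` L" "L \<inter> m ` L = {}" "inj_on m L"
proof -
  have "card S div 2 \<le> card S" by simp
  then obtain L where L: "L \<subseteq> S" "card L = card S div 2" and fin: "finite L"
    by (rule obtain_subset_with_card_n)
  then have "card (S - L) = card L" using L assms by (auto simp: card_Diff_subset elim!: evenE)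
  then obtain m where "bij_betw m L (S - L)"
    using finite_same_card_bij[OF fin, of "S - L"] assms(1) by auto
  then show ?thesis using that[of L m] L(1) by (auto simp: bij_betw_def)
qed

lemma (in minimal_net_source) degree_source_ge_5: "5 \<le> degree N {v}"
proof (rule ccontr)
  assume "\<not> ?thesis"
  then have deg: "degree N {v} = 4" using degree_single_ge_4[OF source(1)] by simp
  then have card: "card star + tips N v = 4" "tips N v \<le> 2"
    using degree_source tips_le_2_if_degree_4 by simp_all
  then have "tip_in N v \<le> card star" by (simp add: tips_def)
  then obtain P where P: "P \<subseteq> star" "card P = tip_in N v" "finite P"
    by (rule obtain_subset_with_card_n)
  then have "tip_out N v \<le> card (star - P)" using card by (simp add: card_Diff_subset tips_def)
  then obtain Q where Q: "Q \<subseteq> star - P" "card Q = tip_out N v" "finite Q"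
    by (rule obtain_subset_with_card_n)
  have "card (star - P - Q) + 2 * tips N v = 4"
    using P Q card by (simp add: card_Diff_subset tips_def)
  then have "even (card (star - P - Q))" by presburger
  then obtain L m where "star - P - Q = L \<union> m ` L" "L \<inter> m ` L = {}" "inj_on m L"
    using obtain_pairing[of "star - P - Q"] by auto
  then interpret splitting N v P Q L m
    using P Q deg by unfold_locales auto
  show False by (rule splitting_impossible)
qed

lemma (in minimal_net) minimal_net_source_reverse_arcs:
  assumes "u \<in> nodes N"
  shows "minimal_net_source (reverse_arcs N {e. head N e = u}) u"
proof -
  interpret reversed: minimal_net "reverse_arcs N {e. head N e = u}"
    by (rule minimal_net_reverse_arcs)
  show ?thesis using assms by unfold_locales (auto simp: reverse_arcs_def split: if_splits)
qed

context minimal_net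
begin

lemma degree_single_ge_5: "u \<in> nodes N \<Longrightarrow> 5 \<le> degree N {u}"
  using minimal_net_source.degree_source_ge_5[OF minimal_net_source_reverse_arcs]
  by (simp add: degree_reverse_arcs)

lemma degree_ge_8:
  assumes A: "A \<subset> nodes N" "2 \<le> card A"
  shows "8 \<le> degree N A"
proof -
  obtain a b where ab: "a \<in> A" "b \<in> A" "a \<noteq> b"
    using A(2) by (auto simp: numeral_2_eq_2 card_le_Suc_iff)
  have "5 \<le> degree N {a}" "5 \<le> degree N {b}" using ab A(1) degree_single_ge_5 by auto
  then have "degree N A \<noteq> 6" "degree N A \<noteq> 7"
    using degree_single_le[OF A ab(1)] degree_7_unique_single[OF A _ ab(1) _ ab(2)] ab(3) by auto
  then show ?thesis using degree_ge_6[OF A] by simp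
qed

lemma eq_singleton_or_degree_ge_8:
  assumes "X \<subset> nodes N" "x \<in> X"
  shows "X = {x} \<or> 2 \<le> card X \<and> 8 \<le> degree N X"
  using eq_singleton_or_degree_ge_6[OF assms] degree_ge_8[OF assms(1)] by auto

end

subsection \<open>Nodes of degree at least five\<close>

text \<open>A tip edge into a resistant node cannot be deleted: the set \<open>{u}\<close> would no longer be ample.\<close>

definition resistant :: "('v, 'e) net \<Rightarrow> 'v \<Rightarrow> bool" where
  "resistant N u \<longleftrightarrow> degree N {u} = 5 \<and> 3 dvd border N {u} - 1 \<or>
     degree N {u} = 6 \<and> 3 dvd border N {u} + 1"

lemma ample_if_resistant:
  assumes "resistant N u"
  shows "ample (degree N {u} - 1) (border N {u} - 1)"
  using assms unfolding resistant_def ample_def by (elim disjE) (simp, simp, presburger)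

lemma ample_if_not_resistant:
  assumes "\<not> resistant N u" "5 \<le> degree N {u}" "ample (degree N {u}) (border N {u})"
  shows "ample (degree N {u} - 1) (border N {u} + 1)"
proof -
  consider (eq_5) "degree N {u} = 5" | (eq_6) "degree N {u} = 6" | (ge_7) "7 \<le> degree N {u}"
    using assms(2) by linarith
  then show ?thesis
  proof cases
    case eq_5
    then have "\<not> 3 dvd border N {u}" "\<not> 3 dvd border N {u} - 1"
      using assms by (auto simp: ample_def resistant_def)
    then have "3 dvd border N {u} + 1" by presburger
    then show ?thesis using eq_5 by (simp add: ample_def)
  next
    case eq_6
    then show ?thesis using assms(1) by (auto simp: ample_def resistant_def)
  qed (simp add: ample_if_ge_6)
qed

definition delete_tip_in :: "('v, 'e) net \<Rightarrow> 'v \<Rightarrow> ('v, 'e) net" where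
  "delete_tip_in N v = N\<lparr>tip_in := (tip_in N)(v := tip_in N v - 1)\<rparr>"

definition reverse_tips :: "('v, 'e) net \<Rightarrow> 'v \<Rightarrow> nat \<Rightarrow> ('v, 'e) net" where
  "reverse_tips N v c = N\<lparr>tip_in := (tip_in N)(v := tip_in N v - c),
     tip_out := (tip_out N)(v := tip_out N v + c)\<rparr>"

lemma sum_add_at:
  fixes f g :: "'a \<Rightarrow> 'b::comm_monoid_add"
  assumes "finite X" "\<And>u. u \<noteq> v \<Longrightarrow> f u = g u" "f v = g v + c"
  shows "(\<Sum>u\<in>X. f u) = (\<Sum>u\<in>X. g u) + (if v \<in> X then c else 0)"
proof -
  have "(\<Sum>u\<in>X. f u) = (\<Sum>u\<in>X. g u + (if u = v then c else 0))"
    using assms(2,3) by (intro sum.cong) auto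
  then show ?thesis using assms(1) by (simp add: sum.distrib)
qed

context
  fixes N :: "('v, 'e) net" and v :: 'v
begin

lemma delete_tip_in_simps [simp]:
  "nodes (delete_tip_in N v) = nodes N" "arcs (delete_tip_in N v) = arcs N"
  "flow (delete_tip_in N v) = flow N" "wf_net (delete_tip_in N v) = wf_net N"
  by (simp_all add: delete_tip_in_def flow_def surplus_def incidence_def wf_net_def fun_eq_iff)

lemma degree_delete_tip_in:
  assumes "finite X" "1 \<le> tip_in N v"
  shows "degree (delete_tip_in N v) X + of_bool (v \<in> X) = degree N X"
  using sum_add_at[OF assms(1), of v "tips N" "tips (delete_tip_in N v)" 1] assms(2)
  by (simp add: degree_def tips_def delete_tip_in_def cut_arcs_def)

lemma border_delete_tip_in:
  assumes "finite X" "1 \<le> tip_in N v"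
  shows "border (delete_tip_in N v) X = border N X + of_bool (v \<in> X)"
  unfolding border_def using assms(2)
  by (subst sum_add_at[OF assms(1), of v _
        "\<lambda>u. demand N u - int (tip_in N u) + int (tip_out N u)" 1])
    (auto simp: delete_tip_in_def of_nat_diff)

lemma reverse_tips_simps [simp]:
  "nodes (reverse_tips N v c) = nodes N" "arcs (reverse_tips N v c) = arcs N"
  "flow (reverse_tips N v c) = flow N" "wf_net (reverse_tips N v c) = wf_net N"
  by (simp_all add: reverse_tips_def flow_def surplus_def incidence_def wf_net_def fun_eq_iff)

lemma degree_reverse_tips:
  assumes "c \<le> tip_in N v"
  shows "degree (reverse_tips N v c) X = degree N X"
proof -
  have "tips (reverse_tips N v c) = tips N"
    using assms by (auto simp: tips_def reverse_tips_def)
  then show ?thesis by (simp add: degree_def) (simp add: cut_arcs_def reverse_tips_def)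
qed

lemma border_reverse_tips:
  assumes "finite X" "c \<le> tip_in N v"
  shows "border (reverse_tips N v c) X = border N X + (if v \<in> X then 2 * int c else 0)"
  unfolding border_def using assms(2)
  by (subst sum_add_at[OF assms(1), of v _
        "\<lambda>u. demand N u - int (tip_in N u) + int (tip_out N u)" "2 * int c"])
    (auto simp: reverse_tips_def of_nat_diff)

end

context minimal_net
begin

lemma obtain_anchor:
  assumes "7 < degree N (nodes N)"
  obtains x where "anchor N (nodes N) x" "7 \<le> degree N {x}"
proof -
  obtain x where x: "anchor N (nodes N) x"
    using anchored assms by (auto simp: anchored_def twin_anchors_def)
  then have "degree N (nodes N) \<le> degree N {x} + 1"
    using anchorD(2)[OF x, of "{x}"] anchorD(1)[OF x] by simp
  then show ?thesis using that x assms by simp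
qed

subsubsection \<open>Deleting a tip edge\<close>

context
  fixes w
  assumes w: "w \<in> nodes N" "1 \<le> tip_in N w"
begin

private lemma degree_tip_deletion:
  "X \<subseteq> nodes N \<Longrightarrow> degree (delete_tip_in N w) X + of_bool (w \<in> X) = degree N X"
  by (rule degree_delete_tip_in[OF finite_node_set w(2)])

private lemma degree_tip_deletion_ge:
  "X \<subseteq> nodes N \<Longrightarrow> degree N X \<le> degree (delete_tip_in N w) X + 1"
  using degree_tip_deletion[of X] by (simp add: of_bool_def split: if_splits)

lemma ample_tip_deletion:
  assumes "\<not> resistant N w"
  shows "ample_net (delete_tip_in N w)"
proof (rule ample_netI)
  fix u assume u: "u \<in> nodes (delete_tip_in N w)"
  show "ample (degree (delete_tip_in N w) {u}) (border (delete_tip_in N w) {u})"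
  proof (cases "u = w")
    case True
    then have "degree (delete_tip_in N w) {u} = degree N {w} - 1"
      using degree_tip_deletion[of "{w}"] w(1) by simp
    moreover have "border (delete_tip_in N w) {u} = border N {w} + 1"
      using True border_delete_tip_in[of "{w}" N w] w(2) by simp
    ultimately show ?thesis
      using ample_if_not_resistant[OF assms] degree_single_ge_5 ample_single w(1) by simp
  next
    case False
    then show ?thesis
      using u degree_tip_deletion[of "{u}"] border_delete_tip_in[of "{u}" N w] w(2) ample_single
      by simp
  qed
next
  fix X assume "X \<subset> nodes (delete_tip_in N w)" "2 \<le> card X"
  then show "6 \<le> degree (delete_tip_in N w) X"
    using degree_ge_8[of X] degree_tip_deletion_ge[of X] by auto
qed simp

lemma anchored_tip_deletion:
  assumes "\<not> resistant N w"
  shows "anchored (delete_tip_in N w) (nodes (delete_tip_in N w))"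
proof -
  note ample = ample_tip_deletion[OF assms]
  have total: "degree (delete_tip_in N w) (nodes N) + 1 = degree N (nodes N)"
    using degree_tip_deletion[of "nodes N"] w(1) by simp
  show ?thesis
  proof (cases "degree N (nodes N) \<le> 7")
    case True
    show ?thesis
    proof (rule anchored_if_degree_le_7[OF _ _ ample])
      show "6 \<le> degree (delete_tip_in N w) X" if "X \<subset> nodes (delete_tip_in N w)" "2 \<le> card X" for X
        using degree_ge_8[of X] degree_tip_deletion_ge[of X] that by auto
      obtain u where u: "u \<in> nodes N" "u \<noteq> w" using obtain_other_node .
      then have "5 \<le> degree (delete_tip_in N w) {u}"
        using degree_tip_deletion[of "{u}"] degree_single_ge_5[OF u(1)] by simp
      then show "\<exists>u\<in>nodes (delete_tip_in N w). 5 \<le> degree (delete_tip_in N w) {u}"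
        using u(1) by auto
    qed (use True total w(1) in auto)
  next
    case False
    then obtain x where x: "anchor N (nodes N) x" using obtain_anchor by auto
    have "anchor (delete_tip_in N w) (nodes N) x"
    proof (rule anchorI)
      fix X assume "X \<subset> nodes N" "x \<in> X"
      then show "degree (delete_tip_in N w) (nodes N) \<le> degree (delete_tip_in N w) X + 1"
        using anchorD(2)[OF x, of X] degree_tip_deletion_ge[of X] total by auto
    qed (rule anchorD(1)[OF x])
    then show ?thesis using anchored_if_anchor by simp
  qed
qed

lemma resistant_if_tip_in: "resistant N w"
proof (rule ccontr)
  assume not_resistant: "\<not> resistant N w"
  have "admissible (delete_tip_in N w)"
    using ample_tip_deletion[OF not_resistant] anchored_tip_deletion[OF not_resistant] wf
    by (simp add: admissible_def)
  moreover have "net_size (delete_tip_in N w) < net_size N"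
    using degree_tip_deletion[of "nodes N"] w(1) by (simp add: net_size_def)
  ultimately show False using smaller_flow no_flow by fastforce
qed

lemma tip_out_eq_0_if_tip_in: "tip_out N w = 0"
proof (rule ccontr)
  assume "tip_out N w \<noteq> 0"
  then have "resistant (mirror N) w"
    using w(1)
    by (intro minimal_net.resistant_if_tip_in[OF minimal_net_mirror]) (auto simp: mirror_def)
  then show False using resistant_if_tip_in
    unfolding resistant_def degree_mirror border_mirror by presburger
qed

end

end

subsubsection \<open>Deleting an arc\<close>

context minimal_net_source
begin

definition spares_anchor :: "'e \<Rightarrow> bool" where
  "spares_anchor e \<longleftrightarrow> degree N (nodes N) \<le> 7 \<and> 3 \<le> card star \<or>
     (\<exists>x. anchor N (nodes N) x \<and> x \<noteq> v \<and> x \<noteq> head N e)"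

lemma obtain_two_heads:
  assumes "3 \<le> card star"
  obtains x y where "x \<in> head N ` star - {u}" "y \<in> head N ` star - {u}" "x \<noteq> y"
proof -
  let ?H = "head N ` star - {u}"
  have "card (head N ` star) - 1 \<le> card ?H"
    using diff_card_le_card_Diff[of "{u}" "head N ` star"] by simp
  then have "\<not> card ?H \<le> Suc 0" using assms card_image[OF inj_on_head_star] by simp
  then obtain x y where "x \<in> ?H" "y \<in> ?H" "x \<noteq> y" using card_le_Suc0_iff_eq[of ?H] by auto
  then show ?thesis by (rule that)
qed

context
  fixes e and s :: int and c
  assumes e: "e \<in> star" and s: "s = 1 \<or> s = -1" and c: "c \<le> tip_in N v"
begin

private abbreviation deletion where
  "deletion \<equiv> reverse_tips (subnet N (nodes N) (arcs N - {e}) (\<lambda>_. s)) v c"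

private lemma e_arc: "e \<in> arcs N" "tail N e = v" "head N e \<noteq> v" "head N e \<in> nodes N"
  using e head_star[OF e] in_star_iff by auto

lemma degree_arc_deletion: "degree deletion X + of_bool (e \<in> cut_arcs N X) = degree N X"
proof -
  have "cut_arcs N X - (arcs N - {e}) = (if e \<in> cut_arcs N X then {e} else {})"
    by (auto simp: cut_arcs_def)
  then have "card (cut_arcs N X - (arcs N - {e})) = of_bool (e \<in> cut_arcs N X)" by simp
  then show ?thesis
    using degree_subnet[OF finite_arcs, of "arcs N - {e}" "nodes N" "\<lambda>_. s" X] c
    by (simp add: degree_reverse_tips)
qed

lemma border_arc_deletion:
  assumes "X \<subseteq> nodes N"
  shows "border deletion X = border N X - s * incidence N e X + (if v \<in> X then 2 * int c else 0)"
proof -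
  have "arcs N - (arcs N - {e}) = {e}" using e_arc(1) by auto
  then show ?thesis
    using c by (simp add: border_reverse_tips border_subnet finite_node_set[OF assms])
qed

lemma remaining_arcs_inner: "arcs N - {e} \<subseteq> inner_arcs N (nodes N)"
  using wf by (auto simp: inner_arcs_def wf_net_def)

lemma flow_outside_nodes: "flow_outside N (nodes N) (\<lambda>_. s)"
  using s by (simp add: flow_outside_def signing_def)

lemma degree_arc_deletion_ge_7:
  assumes "X \<subset> nodes N" "2 \<le> card X"
  shows "7 \<le> degree deletion X"
  using degree_arc_deletion[of X] degree_ge_8[OF assms] by (simp add: of_bool_def split: if_splits)

lemma ample_arc_deletion:
  assumes ample_v: "ample (degree N {v} - 1) (border N {v} - s + 2 * int c)"
    and ample_head: "ample (degree N {head N e} - 1) (border N {head N e} + s)"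
  shows "ample_net deletion"
proof (rule ample_netI)
  fix u assume "u \<in> nodes deletion"
  then have u: "u \<in> nodes N" by simp
  consider (tail) "u = v" | (head) "u = head N e" | (other) "u \<noteq> v" "u \<noteq> head N e" by blast
  then show "ample (degree deletion {u}) (border deletion {u})"
  proof cases
    case tail
    then show ?thesis
      using degree_arc_deletion[of "{v}"] border_arc_deletion[of "{v}"] e e_arc ample_v source(1)
      by (simp add: incidence_def flip: degree_arc_deletion)
  next
    case head
    then show ?thesis
      using degree_arc_deletion[of "{head N e}"] border_arc_deletion[of "{head N e}"]
        e_arc ample_head
      by (simp add: incidence_def cut_arcs_def flip: degree_arc_deletion)
  next
    case other
    then have "e \<notin> cut_arcs N {u}" "incidence N e {u} = 0"
      using e_arc by (auto simp: cut_arcs_def incidence_def)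
    then show ?thesis
      using degree_arc_deletion[of "{u}"] border_arc_deletion[of "{u}"] u other ample_single by simp
  qed
next
  fix X assume "X \<subset> nodes deletion" "2 \<le> card X"
  then show "6 \<le> degree deletion X" using degree_arc_deletion_ge_7[of X] by simp
qed simp

lemma degree_arc_deletion_nodes: "degree deletion (nodes N) = degree N (nodes N)"
  using degree_arc_deletion[of "nodes N"] e_arc source(1) by (simp add: cut_arcs_def)

lemma degree_arc_deletion_other: "x \<noteq> v \<Longrightarrow> x \<noteq> head N e \<Longrightarrow> degree deletion {x} = degree N {x}"
  using degree_arc_deletion[of "{x}"] e_arc by (auto simp: cut_arcs_def)

lemma anchored_arc_deletion_if_small:
  assumes ample: "ample_net deletion" and small: "degree N (nodes N) \<le> 7" "3 \<le> card star"
  shows "anchored deletion (nodes deletion)"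
proof (rule anchored_if_degree_le_7[OF _ _ ample])
  obtain x y where xy: "x \<in> head N ` star - {head N e}" "y \<in> head N ` star - {head N e}" "x \<noteq> y"
    using obtain_two_heads[OF small(2)] .
  have ge_5: "u \<in> nodes deletion \<and> 5 \<le> degree deletion {u}"
    if "u \<in> head N ` star - {head N e}" for u
    using that degree_arc_deletion_other[of u] head_star degree_single_ge_5[of u] by auto
  then show "\<exists>x\<in>nodes deletion. 5 \<le> degree deletion {x}" using xy(1) by blast
  show "\<exists>x\<in>nodes deletion. \<exists>y\<in>nodes deletion. x \<noteq> y \<and> 5 \<le> degree deletion {x} \<and> 5 \<le> degree deletion {y}"
    using ge_5 xy by blast
next
  fix X assume "X \<subset> nodes deletion" "2 \<le> card X"
  then show "6 \<le> degree deletion X" using degree_arc_deletion_ge_7[of X] by simp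
qed (use small(1) nodes_nonempty degree_arc_deletion_nodes in auto)

lemma anchor_arc_deletion:
  assumes x: "anchor N (nodes N) x" "x \<noteq> v" "x \<noteq> head N e"
  shows "anchor deletion (nodes N) x"
proof (rule anchorI)
  fix X assume X: "X \<subset> nodes N" "x \<in> X"
  from eq_singleton_or_degree_ge_8[OF X] consider (single) "X = {x}" | (large) "2 \<le> card X" by blast
  then show "degree deletion (nodes N) \<le> degree deletion X + 1"
  proof cases
    case single
    then show ?thesis
      using anchorD(2)[OF x(1), of X] X(1) degree_arc_deletion_other[OF x(2,3)]
        degree_arc_deletion_nodes
      by auto
  next
    case large
    then show ?thesis
      using degree_nodes_less_if_anchor[OF x(1) X(2,1)] degree_arc_deletion[of X]
        degree_arc_deletion_nodes
      by (simp add: of_bool_def split: if_splits)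
  qed
qed (rule anchorD(1)[OF x(1)])

lemma anchored_arc_deletion:
  assumes "ample_net deletion" "spares_anchor e"
  shows "anchored deletion (nodes deletion)"
  using assms(2) anchored_arc_deletion_if_small[OF assms(1)]
    anchored_if_anchor[OF anchor_arc_deletion]
  by (auto simp: spares_anchor_def)

lemma arc_deletion_impossible:
  assumes "spares_anchor e"
    and "ample (degree N {v} - 1) (border N {v} - s + 2 * int c)"
    and "ample (degree N {head N e} - 1) (border N {head N e} + s)"
  shows False
proof -
  have "wf_net deletion"
    using wf_subnet[OF wf subset_refl remaining_arcs_inner flow_outside_nodes] by simp
  then have "admissible deletion"
    using ample_arc_deletion[OF assms(2,3)] anchored_arc_deletion[OF _ assms(1)]
    by (simp add: admissible_def)
  moreover have "net_size deletion < net_size N"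
  proof -
    have "card (arcs N - {e}) < card (arcs N)" using e_arc(1) by (intro psubset_card_mono) auto
    moreover have "degree deletion (nodes N) \<le> degree N (nodes N)"
      using degree_arc_deletion[of "nodes N"] by simp
    ultimately show ?thesis by (simp add: net_size_def)
  qed
  ultimately obtain g where "flow (subnet N (nodes N) (arcs N - {e}) (\<lambda>_. s)) g"
    using smaller_flow by fastforce
  then show False
    using flow_if_subnet_flow[OF wf remaining_arcs_inner flow_outside_nodes] no_flow by blast
qed

end

end

subsubsection \<open>Deleting a node\<close>

locale minimal_net_tip = minimal_net_source +
  assumes tip_in_ge_1: "1 \<le> tip_in N v"
begin

lemma resistant_v: "resistant N v" and tips_v: "tips N v = tip_in N v"
  using resistant_if_tip_in[OF source(1) tip_in_ge_1]
    tip_out_eq_0_if_tip_in[OF source(1) tip_in_ge_1]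
  by (simp_all add: tips_def)

lemma rest_proper: "rest \<noteq> {}" "rest \<subset> nodes N"
  using nodes_not_singleton[of v] source(1) by auto

text \<open>The arcs at \<open>v\<close> have tail \<open>v\<close>, so the sign \<open>-1\<close> orients all of them towards \<open>v\<close>.\<close>

abbreviation node_deletion where
  "node_deletion \<equiv> subnet N rest (inner_arcs N rest) (\<lambda>_. -1)"

lemma degree_node_deletion:
  assumes "X \<subseteq> rest"
  shows "degree node_deletion X + card (cut_arcs N X \<inter> star) = degree N X"
proof -
  have "cut_arcs N X - inner_arcs N rest = cut_arcs N X \<inter> star"
    using assms wf by (auto simp: cut_arcs_def inner_arcs_def wf_net_def)
  then show ?thesis
    using degree_subnet[OF finite_arcs inner_arcs_subset, of rest rest "\<lambda>_. -1" X] by simp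
qed

lemma border_node_deletion:
  assumes "X \<subseteq> rest"
  shows "border node_deletion X = border N X - int (card (cut_arcs N X \<inter> star))"
proof -
  have X: "finite X" "v \<notin> X" using assms finite_node_set by auto
  have "(\<Sum>e\<in>arcs N - inner_arcs N rest. - 1 * incidence N e X) = (\<Sum>e\<in>cut_arcs N X \<inter> star. 1)"
  proof (rule sum.mono_neutral_cong_right)
    show "cut_arcs N X \<inter> star \<subseteq> arcs N - inner_arcs N rest"
      by (auto simp: cut_arcs_def inner_arcs_def)
    show "\<forall>e\<in>arcs N - inner_arcs N rest - cut_arcs N X \<inter> star. - 1 * incidence N e X = 0"
      using assms wf by (auto simp: cut_arcs_def inner_arcs_def incidence_def wf_net_def)
    fix e assume "e \<in> cut_arcs N X \<inter> star"
    then have "tail N e \<notin> X" "head N e \<in> X"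
      using X(2) in_cut_arcs_iff_head[OF X(2), of e] in_star_iff[of e] by auto
    then show "- 1 * incidence N e X = 1" by (simp add: incidence_def)
  qed simp
  then show ?thesis by (simp add: border_subnet[OF X(1)])
qed

lemma degree_node_deletion_rest: "degree node_deletion rest + tip_in N v = degree N (nodes N)"
  using degree_node_deletion[OF subset_refl] degree_remove_node[OF wf source(1)]
    degree_source tips_v by (simp add: cut_arcs_complement[OF wf])

lemma card_cut_star_single:
  assumes "y \<in> rest"
  shows "card (cut_arcs N {y} \<inter> star) = of_bool (y \<in> head N ` star)"
proof -
  have "cut_arcs N {y} \<inter> star = {e \<in> star. head N e = y}"
    using assms by (auto simp: in_cut_arcs_iff_head)
  moreover have "head N ` {e \<in> star. head N e = y} = (if y \<in> head N ` star then {y} else {})"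
    by auto
  moreover have "card (head N ` {e \<in> star. head N e = y}) = card {e \<in> star. head N e = y}"
    by (intro card_image inj_on_subset[OF inj_on_head_star]) auto
  ultimately show ?thesis by (simp split: if_splits)
qed

context
  assumes deg: "degree N {v} = 5"
    and heads: "\<And>e. e \<in> star \<Longrightarrow> ample (degree N {head N e} - 1) (border N {head N e} - 1)"
begin

lemma flow_outside_rest: "flow_outside N rest (\<lambda>_. -1)"
proof -
  have "(\<Sum>e\<in>arcs N. - 1 * incidence N e {v}) = (\<Sum>e\<in>star. -1)"
  proof (rule sum.mono_neutral_cong_right)
    show "\<forall>e\<in>arcs N - star. - 1 * incidence N e {v} = 0" by (auto simp: cut_arcs_def incidence_def)
    show "- 1 * incidence N e {v} = -1" if "e \<in> star" for e
      using that unfolding in_star_iff by (simp add: incidence_def)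
  qed (auto simp: cut_arcs_def)
  moreover have "border N {v} = demand N v - int (tip_in N v)"
    using tips_v by (simp add: border_def tips_def)
  moreover have "int (card star) = 5 - int (tip_in N v)" using degree_source deg tips_v by simp
  ultimately have "surplus N (\<lambda>_. -1) {v} = - (border N {v} - 1) - 6" by (simp add: surplus_def)
  moreover have "3 dvd border N {v} - 1" using resistant_v deg by (auto simp: resistant_def)
  ultimately have "3 dvd surplus N (\<lambda>_. -1) {v}" by presburger
  then show ?thesis by (auto simp: flow_outside_def signing_def)
qed

lemma card_cut_star_le_4: "card (cut_arcs N X \<inter> star) \<le> 4"
proof -
  have "card (cut_arcs N X \<inter> star) \<le> card star" by (intro card_mono) auto
  then show ?thesis using degree_source deg tips_v tip_in_ge_1 by simp
qed

lemma degree_insert_source: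
  assumes "X \<subseteq> rest"
  shows "degree N (insert v X) + 2 * card (cut_arcs N X \<inter> star) = degree N X + 5"
  using degree_insert[OF finite_arcs, of X v] assms finite_node_set[of X] deg by auto

lemma degree_node_deletion_ge_6:
  assumes X: "X \<subset> rest" "2 \<le> card X"
  shows "6 \<le> degree node_deletion X"
proof -
  have sub: "X \<subseteq> rest" "X \<subset> nodes N" "insert v X \<subset> nodes N" using X(1) source(1) by auto
  have "v \<notin> X" "finite X" using sub finite_node_set by auto
  then have "8 \<le> degree N (insert v X)" using X(2) by (intro degree_ge_8[OF sub(3)]) simp
  moreover have "8 \<le> degree N X" by (rule degree_ge_8[OF sub(2) X(2)])
  ultimately show ?thesis
    using degree_node_deletion[OF sub(1)] degree_insert_source[OF sub(1)] card_cut_star_le_4[of X]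
    by presburger
qed

lemma ample_node_deletion: "ample_net node_deletion"
proof (rule ample_netI)
  fix u assume "u \<in> nodes node_deletion"
  then have u: "u \<in> rest" by simp
  show "ample (degree node_deletion {u}) (border node_deletion {u})"
  proof (cases "u \<in> head N ` star")
    case True
    then have "degree node_deletion {u} = degree N {u} - 1"
      "border node_deletion {u} = border N {u} - 1"
      using degree_node_deletion[of "{u}"] border_node_deletion[of "{u}"] card_cut_star_single[OF u] u
      by auto
    then show ?thesis using heads True by auto
  next
    case False
    then have "degree node_deletion {u} = degree N {u}" "border node_deletion {u} = border N {u}"
      using degree_node_deletion[of "{u}"] border_node_deletion[of "{u}"] card_cut_star_single[OF u] u
      by auto
    then show ?thesis using ample_single[of u] u by simp
  qed
next
  show "6 \<le> degree node_deletion X" if "X \<subset> nodes node_deletion" "2 \<le> card X" for X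
    using degree_node_deletion_ge_6 that by simp
qed simp

lemma anchor_node_deletion:
  assumes x: "anchor N (nodes N) x" "x \<noteq> v"
  shows "anchor node_deletion rest x"
proof (rule anchorI)
  show x_rest: "x \<in> rest" using anchorD(1)[OF x(1)] x(2) by simp
  fix X assume X: "X \<subset> rest" "x \<in> X"
  then have sub: "X \<subseteq> rest" "X \<subset> nodes N" "insert v X \<subset> nodes N" using source(1) by auto
  have fin: "finite X" "v \<notin> X" using sub finite_node_set by auto
  from eq_singleton_or_degree_ge_8[OF sub(2) X(2)] consider (single) "X = {x}" | (large) "2 \<le> card X"
    by blast
  then show "degree node_deletion rest \<le> degree node_deletion X + 1"
  proof cases
    case single
    then have "card (cut_arcs N X \<inter> star) \<le> 1" using card_cut_star_single[OF x_rest] by simp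
    moreover have "degree N (nodes N) \<le> degree N X + 1"
      using anchorD(2)[OF x(1)] sub(2) X(2) by auto
    ultimately show ?thesis
      using degree_node_deletion[OF sub(1)] degree_node_deletion_rest tip_in_ge_1 by linarith
  next
    case large
    have "degree N (nodes N) < degree N X"
      by (rule degree_nodes_less_if_anchor[OF x(1) X(2) sub(2) large])
    moreover have "degree N (nodes N) < degree N (insert v X)"
      using large fin X(2) by (intro degree_nodes_less_if_anchor[OF x(1) _ sub(3)]) auto
    ultimately show ?thesis
      using degree_node_deletion[OF sub(1)] degree_insert_source[OF sub(1)]
        degree_node_deletion_rest
        card_cut_star_le_4[of X] tip_in_ge_1 by presburger
  qed
qed

lemma anchored_node_deletion_if_small:
  assumes small: "degree N (nodes N) \<le> 7"
    and far: "degree N (nodes N) = 7 \<Longrightarrow> tip_in N v = 1 \<Longrightarrow> \<exists>t\<in>rest. t \<notin> head N ` star"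
  shows "anchored node_deletion (nodes node_deletion)"
proof (rule anchored_if_degree_le_7[OF _ _ ample_node_deletion])
  show "6 \<le> degree node_deletion X" if "X \<subset> nodes node_deletion" "2 \<le> card X" for X
    using degree_node_deletion_ge_6 that by simp
  assume "degree node_deletion (nodes node_deletion) = 6"
  then have "degree N (nodes N) = 7" "tip_in N v = 1"
    using degree_node_deletion_rest small tip_in_ge_1 by simp_all
  then obtain t where t: "t \<in> rest" "t \<notin> head N ` star" using far by blast
  then have "degree node_deletion {t} = degree N {t}"
    using degree_node_deletion[of "{t}"] card_cut_star_single[of t] by auto
  then show "\<exists>t\<in>nodes node_deletion. 5 \<le> degree node_deletion {t}"
    using t(1) degree_single_ge_5[of t] by (intro bexI[of _ t]) auto
qed (use small rest_proper degree_node_deletion_rest tip_in_ge_1 in auto)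

lemma node_deletion_not_anchored: "\<not> anchored node_deletion (nodes node_deletion)"
proof
  assume "anchored node_deletion (nodes node_deletion)"
  then have "admissible node_deletion"
    using ample_node_deletion wf_subnet[OF wf psubset_imp_subset[OF rest_proper(2)]
      subset_refl flow_outside_rest]
    by (simp add: admissible_def)
  moreover have "net_size node_deletion < net_size N"
  proof -
    have "card rest < card (nodes N)" using rest_proper(2) by (intro psubset_card_mono) auto
    moreover have "card (inner_arcs N rest) \<le> card (arcs N)"
      by (intro card_mono inner_arcs_subset) simp
    ultimately show ?thesis using degree_node_deletion_rest by (simp add: net_size_def)
  qed
  ultimately obtain g where "flow node_deletion g" using smaller_flow by blast
  then show False
    using flow_if_subnet_flow[OF wf subset_refl flow_outside_rest]
      no_flow by blast
qed

end

subsubsection \<open>A minimal counterexample has no tip edges\<close>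

lemma degree_5_or_6: "degree N {v} = 5 \<or> degree N {v} = 6"
  using resistant_v by (auto simp: resistant_def)

lemma card_star_ge_3_if_small:
  assumes small: "degree N (nodes N) \<le> 7"
  shows "3 \<le> card star"
proof -
  have eq: "degree N rest + 2 * tips N v = degree N (nodes N) + degree N {v}"
    by (rule degree_remove_node[OF wf source(1)])
  obtain w where w: "w \<in> rest" using rest_proper(1) by blast
  from eq_singleton_or_degree_ge_8[OF rest_proper(2) w] show ?thesis
  proof
    assume rest: "rest = {w}"
    have "head N ` star \<subseteq> {w}" using head_star rest by blast
    then have "card star \<le> 1"
      using card_mono[of "{w}" "head N ` star"] card_image[OF inj_on_head_star] by simp
    moreover have "5 \<le> degree N rest" unfolding rest using w by (intro degree_single_ge_5) simp
    ultimately show ?thesis using eq small degree_source degree_5_or_6 by presburger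
  next
    assume "2 \<le> card rest \<and> 8 \<le> degree N rest"
    then show ?thesis using eq small degree_source degree_5_or_6 by presburger
  qed
qed

lemma spares_anchor_if_small: "degree N (nodes N) \<le> 7 \<Longrightarrow> spares_anchor e"
  using card_star_ge_3_if_small by (simp add: spares_anchor_def)

lemma obtain_anchor_not_v:
  assumes "\<not> degree N (nodes N) \<le> 7"
  obtains x where "anchor N (nodes N) x" "x \<noteq> v" "7 \<le> degree N {x}"
proof -
  obtain x where "anchor N (nodes N) x" "7 \<le> degree N {x}" using obtain_anchor assms by auto
  moreover from this have "x \<noteq> v" using degree_5_or_6 by auto
  ultimately show ?thesis using that by simp
qed

lemma ample_head:
  assumes e: "e \<in> star"
  shows "ample (degree N {head N e} - 1) (border N {head N e} - 1)"
proof (cases "spares_anchor e")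
  case True
  have "resistant N (head N e)"
  proof (rule ccontr)
    assume "\<not> resistant N (head N e)"
    then have "ample (degree N {head N e} - 1) (border N {head N e} + 1)"
      using head_star[OF e] by (intro ample_if_not_resistant degree_single_ge_5 ample_single) auto
    then show False
      using arc_deletion_impossible[OF e, of 1 0] True ample_if_resistant[OF resistant_v] by simp
  qed
  then show ?thesis by (rule ample_if_resistant)
next
  case False
  then have "\<not> degree N (nodes N) \<le> 7" using spares_anchor_if_small by blast
  then obtain x where "anchor N (nodes N) x" "x \<noteq> v" "7 \<le> degree N {x}"
    by (rule obtain_anchor_not_v)
  then have "7 \<le> degree N {head N e}" using False by (auto simp: spares_anchor_def)
  then show ?thesis by (intro ample_if_ge_6) simp
qed

lemma degree_not_6: "degree N {v} \<noteq> 6"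
proof
  assume deg: "degree N {v} = 6"
  obtain e where e: "e \<in> star" "spares_anchor e"
  proof (cases "degree N (nodes N) \<le> 7")
    case True
    then have "star \<noteq> {}" using card_star_ge_3_if_small by auto
    then show ?thesis using that spares_anchor_if_small[OF True] by blast
  next
    case False
    then obtain x where x: "anchor N (nodes N) x" "x \<noteq> v" by (rule obtain_anchor_not_v)
    then have "degree N (nodes N) \<le> degree N rest + 1" using anchorD[OF x(1)] by auto
    then have "3 \<le> card star"
      using degree_remove_node[OF wf source(1)] deg degree_source by presburger
    then obtain y where "y \<in> head N ` star - {x}" by (rule obtain_two_heads)
    then show ?thesis using that x by (auto simp: spares_anchor_def)
  qed
  have "3 dvd border N {v} + 1" using resistant_v deg by (simp add: resistant_def)
  then have "\<not> 3 dvd border N {v} + 3" by presburger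
  then have "ample (degree N {v} - 1) (border N {v} - (- 1) + 2 * int 1)"
    using deg by (simp add: ample_def)
  then show False
    using arc_deletion_impossible[OF e(1), of "-1" 1] e(2) ample_head[OF e(1)] tip_in_ge_1 by simp
qed

lemma exists_non_neighbour:
  assumes deg: "degree N {v} = 5" and total: "degree N (nodes N) = 7" "tip_in N v = 1"
    and tips_le: "\<And>w. w \<in> nodes N \<Longrightarrow> tips N w \<le> 1"
  shows "\<exists>t\<in>rest. t \<notin> head N ` star"
proof (rule ccontr)
  assume "\<not> ?thesis"
  then have "rest \<subseteq> head N ` star" by blast
  then have "card rest \<le> card (head N ` star)" by (intro card_mono) auto
  also have "\<dots> = 4" using card_image[OF inj_on_head_star] degree_source deg total(2) tips_v by simp
  finally have "card (nodes N) \<le> 5" using source(1) by (simp add: card_Diff_singleton)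
  moreover have "degree N (nodes N) \<le> card (nodes N)"
    using sum_mono[of "nodes N" "tips N" "\<lambda>_. 1"] tips_le by (simp add: degree_nodes[OF wf])
  ultimately show False using total(1) by simp
qed

lemma tip_in_impossible:
  assumes "degree N (nodes N) = 7 \<Longrightarrow> 2 \<le> tips N v \<or> (\<forall>w\<in>nodes N. tips N w \<le> 1)"
  shows False
proof -
  have deg: "degree N {v} = 5" using degree_5_or_6 degree_not_6 by blast
  have "anchored node_deletion (nodes node_deletion)"
  proof (cases "degree N (nodes N) \<le> 7")
    case True
    show ?thesis
    proof (rule anchored_node_deletion_if_small[OF deg ample_head True])
      assume total: "degree N (nodes N) = 7" "tip_in N v = 1"
      then show "\<exists>t\<in>rest. t \<notin> head N ` star"
        using assms tips_v by (intro exists_non_neighbour[OF deg]) auto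
    qed
  next
    case False
    then obtain x where "anchor N (nodes N) x" "x \<noteq> v" by (rule obtain_anchor_not_v)
    then have "anchor node_deletion rest x" by (intro anchor_node_deletion[OF deg ample_head])
    then show ?thesis using anchored_if_anchor by simp
  qed
  then show False using node_deletion_not_anchored[OF deg ample_head] by blast
qed

end

context minimal_net
begin

lemma tip_in_eq_0:
  assumes w: "w \<in> nodes N"
    and max: "degree N (nodes N) = 7 \<Longrightarrow> 2 \<le> tips N w \<or> (\<forall>u\<in>nodes N. tips N u \<le> 1)"
  shows "tip_in N w = 0"
proof (rule ccontr)
  assume "tip_in N w \<noteq> 0"
  let ?M = "reverse_arcs N {e. head N e = w}"
  have same: "nodes ?M = nodes N" "tip_in ?M = tip_in N" "tips ?M = tips N"
    by (simp_all add: reverse_arcs_def tips_def fun_eq_iff)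
  interpret reversed: minimal_net_source ?M w by (rule minimal_net_source_reverse_arcs[OF w])
  interpret reversed: minimal_net_tip ?M w
    using \<open>tip_in N w \<noteq> 0\<close> by unfold_locales (simp add: same)
  show False using reversed.tip_in_impossible max by (simp add: degree_reverse_arcs same)
qed

lemma minimal_net_impossible: False
proof -
  have "Max (tips N ` nodes N) \<in> tips N ` nodes N" using nodes_nonempty by (intro Max_in) auto
  then obtain w where "w \<in> nodes N" "tips N w = Max (tips N ` nodes N)" by auto
  then have w: "w \<in> nodes N" "\<And>u. u \<in> nodes N \<Longrightarrow> tips N u \<le> tips N w" by auto
  have "tips N w \<noteq> 0"
  proof
    assume "tips N w = 0"
    then have "degree N (nodes N) = 0" using w(2) by (simp add: degree_nodes[OF wf])
    then show False using degree_nodes_pos by simp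
  qed
  have max: "2 \<le> tips N w \<or> (\<forall>u\<in>nodes N. tips N u \<le> 1)"
  proof (cases "2 \<le> tips N w")
    case False
    then show ?thesis using w(2) by fastforce
  qed simp
  have "tip_in N w = 0" by (rule tip_in_eq_0[OF w(1) max])
  moreover have "tip_in (mirror N) w = 0"
  proof (rule minimal_net.tip_in_eq_0[OF minimal_net_mirror])
    have "nodes (mirror N) = nodes N" "tips (mirror N) = tips N"
      by (simp_all add: mirror_def tips_def fun_eq_iff)
    then show "w \<in> nodes (mirror N)"
      "2 \<le> tips (mirror N) w \<or> (\<forall>u\<in>nodes (mirror N). tips (mirror N) u \<le> 1)"
      using w(1) max by simp_all
  qed
  then have "tip_out N w = 0" by (simp add: mirror_def)
  ultimately show False using \<open>tips N w \<noteq> 0\<close> by (simp add: tips_def)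
qed

end

theorem flow_if_admissible:
  fixes N :: "('v, 'e) net"
  assumes "admissible N"
  shows "\<exists>f. flow N f"
  using assms
proof (induction "net_size N" arbitrary: N rule: less_induct)
  case less
  show ?case
  proof (rule ccontr)
    assume "\<nexists>f. flow N f"
    then interpret minimal_net N
      using less by unfold_locales auto
    show False by (rule minimal_net_impossible)
  qed
qed

subsection \<open>From canvases to nets\<close>

lemma of_int_mod_3_eq_0_iff: "(of_int n :: 3) = 0 \<longleftrightarrow> 3 dvd n"
  by (simp add: of_int_eq_0_iff_char_dvd)

lemma of_int_mod_3_surj: "\<exists>n. of_int n = (x::3)"
  by (metis bit1_cases)

lemma sum_Z3_boundary:
  assumes "graph G" "Z3_boundary G \<beta>"
  shows "(\<Sum>v\<in>verts G. \<beta> v) = 0"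
proof -
  let ?c = "\<lambda>u. {v \<in> verts G. (u, v) \<in> (adjacency G)\<^sup>*}"
  have sym: "sym ((adjacency G)\<^sup>*)"
    by (intro sym_rtrancl) (auto simp: sym_def adjacency_def insert_commute)
  have class_eq: "?c u = ?c v" if "(u, v) \<in> (adjacency G)\<^sup>*" for u v
    using that sym by (auto dest: symD intro: rtrancl_trans)
  have components: "components G = ?c ` verts G" by (auto simp: components_def)
  have "(\<Sum>v\<in>\<Union> (components G). \<beta> v) = (\<Sum>C\<in>components G. \<Sum>v\<in>C. \<beta> v)"
  proof (rule sum.Union_disjoint[unfolded comp_def])
    show "\<forall>C\<in>components G. finite C" using assms by (auto simp: components graph_def)
    show "\<forall>A\<in>components G. \<forall>B\<in>components G. A \<noteq> B \<longrightarrow> A \<inter> B = {}"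
    proof (intro ballI impI)
      fix A B assume "A \<in> components G" "B \<in> components G" "A \<noteq> B"
      then obtain u w where uw: "A = ?c u" "B = ?c w" by (auto simp: components)
      show "A \<inter> B = {}"
      proof (rule ccontr)
        assume "A \<inter> B \<noteq> {}"
        then obtain y where "(u, y) \<in> (adjacency G)\<^sup>*" "(w, y) \<in> (adjacency G)\<^sup>*" using uw by auto
        from this[THEN class_eq] show False using uw \<open>A \<noteq> B\<close> by simp
      qed
    qed
  qed
  moreover have "\<Union> (components G) = verts G" by (auto simp: components)
  ultimately show ?thesis using assms(2) by (simp add: Z3_boundary_def)
qed

lemma card_pair_Int_eq_1: "a \<noteq> b \<Longrightarrow> card ({a, b} \<inter> X) = 1 \<longleftrightarrow> (a \<in> X) \<noteq> (b \<in> X)"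
  by (cases "a \<in> X"; cases "b \<in> X") auto

lemma deg_minus_vertex:
  assumes "graph G"
  shows "deg G (verts G - {z}) = vdeg G z"
proof -
  have "card (ends G e \<inter> (verts G - {z})) = 1 \<longleftrightarrow> z \<in> ends G e" if "e \<in> edges G" for e
  proof -
    have e: "ends G e \<subseteq> verts G" "card (ends G e) = 2" using assms that by (auto simp: graph_def)
    then have "ends G e \<inter> (verts G - {z}) = ends G e - {z}" by auto
    then show ?thesis using e(2) by (simp add: card_Diff_singleton_if)
  qed
  then show ?thesis by (simp add: deg_def vdeg_def incident_edges_def cong: conj_cong)
qed

definition imbalance :: "'e set \<Rightarrow> ('e \<Rightarrow> 'v \<times> 'v) \<Rightarrow> 'v \<Rightarrow> int" where
  "imbalance F D v = (\<Sum>e\<in>F. of_bool (fst (D e) = v) - of_bool (snd (D e) = v))"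

lemma imbalance_eq: "finite F \<Longrightarrow> imbalance F D v = int (outdeg F D v) - int (indeg F D v)"
  by (simp add: imbalance_def outdeg_def indeg_def sum_subtractf Int_def)

lemma of_int_imbalance:
  "finite F \<Longrightarrow>
    of_int (imbalance F D v) = (of_nat (outdeg F D v) - of_nat (indeg F D v) :: 'a::ring_1)"
  by (simp add: imbalance_eq)

lemma sum_imbalance:
  assumes "finite V" "\<And>e. e \<in> F \<Longrightarrow> fst (D e) \<in> V \<and> snd (D e) \<in> V"
  shows "(\<Sum>v\<in>V. imbalance F D v) = 0"
proof -
  have "(\<Sum>v\<in>V. of_bool (w = v)) = (1 :: int)" if "w \<in> V" for w
    using assms(1) that by (simp add: of_bool_def sum.delta')
  then show ?thesis
    unfolding imbalance_def using assms(2) by (subst sum.swap) (simp add: sum_subtractf)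
qed

lemma outdeg_plus_indeg:
  assumes "graph G" "F \<subseteq> edges G" "orientation_on G F D"
  shows "outdeg F D v + indeg F D v = card {e \<in> F. v \<in> ends G e}"
proof -
  have ends: "ends G e = {fst (D e), snd (D e)}" "fst (D e) \<noteq> snd (D e)" if "e \<in> F" for e
  proof -
    show ends: "ends G e = {fst (D e), snd (D e)}"
      using assms(3) that by (simp add: orientation_on_def)
    have "card (ends G e) = 2" using assms(1,2) that by (auto simp: graph_def)
    then show "fst (D e) \<noteq> snd (D e)" using ends by auto
  qed
  have "finite F" using assms(1,2) by (auto simp: graph_def intro: finite_subset)
  then have "outdeg F D v + indeg F D v = card ({e \<in> F. fst (D e) = v} \<union> {e \<in> F. snd (D e) = v})"
    unfolding outdeg_def indeg_def by (intro card_Un_disjoint[symmetric]) (auto dest: ends(2))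
  also have "{e \<in> F. fst (D e) = v} \<union> {e \<in> F. snd (D e) = v} = {e \<in> F. v \<in> ends G e}"
    using ends(1) by auto
  finally show ?thesis .
qed

locale canvas_preflow =
  fixes G :: "('v, 'e) mgraph" and \<beta> :: "'v \<Rightarrow> 3" and z :: 'v and \<psi> :: "'e \<Rightarrow> 'v \<times> 'v"
  assumes canvas: "canvas G \<beta> z" and preflow: "tip_preflow G \<beta> z \<psi>"
begin

abbreviation tip_edges where "tip_edges \<equiv> incident_edges G z"

definition direction :: "'e \<Rightarrow> 'v \<times> 'v" where
  "direction e = (SOME p. ends G e = {fst p, snd p})"

definition remaining_demand :: "'v \<Rightarrow> int" where
  "remaining_demand v = (SOME n. of_int n = \<beta> v - of_int (imbalance tip_edges \<psi> v))"

definition canvas_net :: "('v, 'e) net" where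
  "canvas_net = \<lparr>nodes = verts G - {z}, arcs = edges G - tip_edges,
     tail = (\<lambda>e. fst (direction e)), head = (\<lambda>e. snd (direction e)),
     tip_in = indeg tip_edges \<psi>, tip_out = outdeg tip_edges \<psi>, demand = remaining_demand\<rparr>"

lemma canvas_net_simps [simp]:
  "nodes canvas_net = verts G - {z}" "arcs canvas_net = edges G - tip_edges"
  "tail canvas_net e = fst (direction e)" "head canvas_net e = snd (direction e)"
  "tip_in canvas_net = indeg tip_edges \<psi>" "tip_out canvas_net = outdeg tip_edges \<psi>"
  "demand canvas_net = remaining_demand"
  by (simp_all add: canvas_net_def)

lemma graph: "graph G" and z_in_verts: "z \<in> verts G"
  using canvas by (auto simp: canvas_def)

lemma finite_sets [simp]: "finite (verts G)" "finite (edges G)" "finite tip_edges"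
  using graph by (auto simp: graph_def incident_edges_def)

lemma of_int_remaining_demand: "of_int (remaining_demand v) =
    \<beta> v - of_int (imbalance tip_edges \<psi> v)"
  unfolding remaining_demand_def using of_int_mod_3_surj by (rule someI_ex)

lemma direction:
  assumes "e \<in> edges G"
  shows "ends G e = {fst (direction e), snd (direction e)}" "fst (direction e) \<noteq> snd (direction e)"
    "fst (direction e) \<in> verts G" "snd (direction e) \<in> verts G"
proof -
  have e: "card (ends G e) = 2" "ends G e \<subseteq> verts G" using graph assms by (auto simp: graph_def)
  then obtain a b where "ends G e = {a, b}" by (auto simp: card_2_iff)
  then have "ends G e = {fst (a, b), snd (a, b)}" by simp
  then show eq: "ends G e = {fst (direction e), snd (direction e)}"
    unfolding direction_def by (rule someI)
  show "fst (direction e) \<noteq> snd (direction e)" using e(1) unfolding eq by auto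
  show "fst (direction e) \<in> verts G" "snd (direction e) \<in> verts G" using e(2) unfolding eq by auto
qed

lemma card_ends_Int_eq_1:
  "e \<in> edges G \<Longrightarrow> card (ends G e \<inter> X) = 1 \<longleftrightarrow> (fst (direction e) \<in> X) \<noteq> (snd (direction e) \<in> X)"
  by (simp only: direction(1) card_pair_Int_eq_1[OF direction(2)])

lemma direction_rest:
  "e \<in> edges G - tip_edges \<Longrightarrow> fst (direction e) \<in> verts G - {z} \<and> snd (direction e) \<in> verts G - {z}"
  using direction[of e] by (auto simp: incident_edges_def)

lemma preflow_orientation: "orientation_on G tip_edges \<psi>"
  using preflow by (simp add: tip_preflow_def)

lemma of_int_imbalance_z: "of_int (imbalance tip_edges \<psi> z) = \<beta> z"
  using preflow by (simp add: of_int_imbalance tip_preflow_def)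

lemma wf_canvas_net: "wf_net canvas_net"
proof -
  let ?i = "imbalance tip_edges \<psi>" and ?V = "verts G - {z}"
  have "fst (\<psi> e) \<in> verts G \<and> snd (\<psi> e) \<in> verts G" if "e \<in> tip_edges" for e
    using that preflow_orientation graph
    by (auto simp: orientation_on_def graph_def incident_edges_def)
  then have "(\<Sum>v\<in>verts G. ?i v) = 0" by (intro sum_imbalance) auto
  then have "(\<Sum>v\<in>?V. ?i v) = - ?i z"
    using sum.remove[OF finite_sets(1) z_in_verts, of ?i] by simp
  moreover have "(\<Sum>v\<in>?V. \<beta> v) = - \<beta> z"
    using sum_Z3_boundary[of G \<beta>] canvas sum.remove[OF finite_sets(1) z_in_verts, of \<beta>]
    by (simp add: canvas_def eq_neg_iff_add_eq_0 add.commute)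
  moreover have "of_int (\<Sum>v\<in>?V. remaining_demand v) = (\<Sum>v\<in>?V. \<beta> v) - of_int (\<Sum>v\<in>?V. ?i v)"
    by (simp add: of_int_remaining_demand sum_subtractf)
  ultimately have "of_int (\<Sum>v\<in>?V. remaining_demand v) = (0 :: 3)"
    by (simp only: of_int_minus of_int_imbalance_z) simp
  then show ?thesis
    using direction_rest by (simp add: wf_net_def flip: of_int_mod_3_eq_0_iff del: of_int_sum)
qed

lemma of_int_border_canvas_net: "of_int (border canvas_net X) = (\<Sum>v\<in>X. \<beta> v)"
  by (simp add: border_def of_int_remaining_demand of_int_imbalance)

lemma degree_canvas_net:
  assumes X: "X \<subseteq> verts G - {z}"
  shows "degree canvas_net X = deg G X"
proof -
  let ?E = "\<lambda>F. {e \<in> F. card (ends G e \<inter> X) = 1}"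
  have fin: "finite X" using X finite_subset by fastforce
  have "(\<Sum>v\<in>X. tips canvas_net v) = (\<Sum>v\<in>X. card {e \<in> tip_edges. v \<in> ends G e})"
    using outdeg_plus_indeg[OF graph _ preflow_orientation]
    by (simp add: tips_def add.commute incident_edges_def)
  also have "\<dots> = card (\<Union>v\<in>X. {e \<in> tip_edges. v \<in> ends G e})"
  proof (rule card_UN_disjoint[symmetric, OF fin])
    show "\<forall>u\<in>X. \<forall>v\<in>X. u \<noteq> v \<longrightarrow> {e \<in> tip_edges. u \<in> ends G e} \<inter> {e \<in> tip_edges. v \<in> ends G e} = {}"
      using X direction(1) by (fastforce simp: incident_edges_def)
  qed simp
  also have "(\<Union>v\<in>X. {e \<in> tip_edges. v \<in> ends G e}) = ?E tip_edges"
  proof -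
    have "card (ends G e \<inter> X) = 1 \<longleftrightarrow> (\<exists>v\<in>X. v \<in> ends G e)" if "e \<in> tip_edges" for e
    proof -
      have e: "e \<in> edges G" "z \<in> ends G e" using that by (auto simp: incident_edges_def)
      then show ?thesis
        unfolding card_ends_Int_eq_1[OF e(1)] using X direction(1)[OF e(1)] by auto
    qed
    then show ?thesis by auto
  qed
  moreover have "cut_arcs canvas_net X = ?E (edges G - tip_edges)"
    by (auto simp only: cut_arcs_def canvas_net_simps mem_Collect_eq card_ends_Int_eq_1 Diff_iff)
  moreover have "card (?E (edges G)) = card (?E (edges G - tip_edges)) + card (?E tip_edges)"
  proof -
    have "?E (edges G) = ?E (edges G - tip_edges) \<union> ?E tip_edges" by (auto simp: incident_edges_def)
    then show ?thesis by (simp only:) (intro card_Un_disjoint, auto)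
  qed
  ultimately show ?thesis by (simp add: degree_def deg_def)
qed

lemma ample_canvas_net:
  assumes "\<And>A. A \<noteq> {} \<Longrightarrow> A \<subset> verts G - {z} \<Longrightarrow> 4 + abs_tau G \<beta> A \<le> deg G A"
  shows "ample_net canvas_net"
  unfolding ample_net_def canvas_net_simps
proof (intro allI impI, elim conjE)
  fix A assume A: "A \<noteq> {}" "A \<subset> verts G - {z}"
  have "(\<Sum>v\<in>A. \<beta> v) = 0 \<longleftrightarrow> 3 dvd border canvas_net A"
    by (simp flip: of_int_border_canvas_net add: of_int_mod_3_eq_0_iff)
  then show "ample (degree canvas_net A) (border canvas_net A)"
    using assms[OF A] A(2) by (auto simp: degree_canvas_net ample_def abs_tau_def split: if_splits)
qed

lemma anchored_canvas_net:
  assumes x: "x \<in> verts G - {z}"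
    and deg: "\<And>X. X \<subseteq> verts G - {z} \<Longrightarrow> x \<in> X \<Longrightarrow> int (deg G X) > int (vdeg G z) - 2"
  shows "anchored canvas_net (verts G - {z})"
proof -
  have "anchor canvas_net (verts G - {z}) x"
  proof (rule anchorI[OF x])
    fix X assume X: "X \<subset> verts G - {z}" "x \<in> X"
    then show "degree canvas_net (verts G - {z}) \<le> degree canvas_net X + 1"
      using deg[of X] by (simp add: degree_canvas_net deg_minus_vertex[OF graph] psubset_imp_subset)
  qed
  then show ?thesis by (rule anchored_if_anchor)
qed

definition oriented :: "('e \<Rightarrow> int) \<Rightarrow> 'e \<Rightarrow> 'v \<times> 'v" where
  "oriented f e = (if e \<in> tip_edges then \<psi> e
     else if f e = 1 then direction e else prod.swap (direction e))"

lemma imbalance_oriented: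
  assumes "signing (arcs canvas_net) f"
  shows "imbalance (edges G) (oriented f) v =
    (\<Sum>e\<in>arcs canvas_net. f e * incidence canvas_net e {v}) + imbalance tip_edges \<psi> v"
proof -
  have "tip_edges \<subseteq> edges G" by (auto simp: incident_edges_def)
  then have "imbalance (edges G) (oriented f) v =
      imbalance (edges G - tip_edges) (oriented f) v + imbalance tip_edges (oriented f) v"
    unfolding imbalance_def by (intro sum.subset_diff) auto
  also have "imbalance tip_edges (oriented f) v = imbalance tip_edges \<psi> v"
    by (auto simp: imbalance_def oriented_def intro!: sum.cong)
  also have "imbalance (edges G - tip_edges) (oriented f) v =
      (\<Sum>e\<in>arcs canvas_net. f e * incidence canvas_net e {v})"
    unfolding imbalance_def using assms
    by (auto simp: oriented_def incidence_def signing_def intro!: sum.cong)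
  finally show ?thesis .
qed

lemma extends_to_flow_if_flow:
  assumes f: "flow canvas_net f"
  shows "extends_to_flow G \<beta> z \<psi>"
proof -
  have sign: "signing (arcs canvas_net) f" using f by (simp add: flow_def)
  have "orientation_on G (edges G) (oriented f)"
    using preflow_orientation direction(1) by (auto simp: orientation_on_def oriented_def)
  moreover have "of_int (imbalance (edges G) (oriented f) v) = \<beta> v" if v: "v \<in> verts G" for v
  proof (cases "v = z")
    case True
    have "(\<Sum>e\<in>arcs canvas_net. f e * incidence canvas_net e {z}) = 0"
      using direction_rest by (intro sum.neutral) (auto simp: incidence_def)
    then show ?thesis by (simp only: imbalance_oriented[OF sign] True of_int_imbalance_z add_0)
  next
    case False
    then have "3 dvd surplus canvas_net f {v}" using f v by (simp add: flow_def)
    then have "(of_int (surplus canvas_net f {v}) :: 3) = 0" by (simp only: of_int_mod_3_eq_0_iff)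
    then have "(of_int (\<Sum>e\<in>arcs canvas_net. f e * incidence canvas_net e {v}) :: 3) =
        of_int (remaining_demand v)"
      by (simp only: surplus_def of_int_diff) simp
    then show ?thesis
      by (simp only: imbalance_oriented[OF sign] of_int_add of_int_remaining_demand diff_add_cancel)
  qed
  ultimately have "nowhere_zero_flow G \<beta> (oriented f)"
    by (simp add: nowhere_zero_flow_def of_int_imbalance)
  then show ?thesis
    unfolding extends_to_flow_def by (intro exI[of _ "oriented f"]) (simp add: oriented_def)
qed

end

theorem mainTheorem3:
  fixes G :: "('v, 'e) mgraph" and \<beta> :: "'v \<Rightarrow> 3" and z :: 'v
  assumes "canvas G \<beta> z"
    and "\<forall>A. A \<noteq> {} \<and> A \<subset> verts G - {z} \<longrightarrow> deg G A \<ge> 4 + abs_tau G \<beta> A"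
    and "\<exists>x\<in>verts G - {z}. \<forall>X. X \<subseteq> verts G - {z} \<and> x \<in> X \<longrightarrow>
           int (deg G X) > int (vdeg G z) - 2"
  shows "\<forall>\<psi>. tip_preflow G \<beta> z \<psi> \<longrightarrow> extends_to_flow G \<beta> z \<psi>"
proof (intro allI impI)
  fix \<psi> assume "tip_preflow G \<beta> z \<psi>"
  then interpret canvas_preflow G \<beta> z \<psi> using assms(1) by unfold_locales
  have "ample_net canvas_net" using assms(2) by (intro ample_canvas_net) blast
  moreover have "anchored canvas_net (nodes canvas_net)"
    using assms(3) anchored_canvas_net by auto
  ultimately have "admissible canvas_net" using wf_canvas_net by (simp add: admissible_def)
  then obtain f where "flow canvas_net f" using flow_if_admissible by blast
  then show "extends_to_flow G \<beta> z \<psi>" by (rule extends_to_flow_if_flow)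
qed

end
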